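(* Let $1<p\le2$ and $p^{-1}+p'^{-1}=1$. For $f\in L^p(\mathbb{R}_+)$ define the maximal Laplace transform $$\mathcal{L}^*f(y)=\sup_{x>0}|\mathcal{L}f(x+iy)|,\qquad y\in\mathbb{R}.$$ Then the inequality $$\left(\int_{-\infty}^\infty|\mathcal{L}^*f(y)|^{p'}\,dy\right)^{1/p'}\le K_{10}(p)\,\|f\|_{L^p(\mathbb{R}_+)}$$ holds for all $f\in L^p(\mathbb{R}_+)$ with a constant $K_{10}(p)\le(192\pi)^{1/p'}$. (In particular, $\mathcal{L}^*f<\infty$ almost everywhere.)
   Context: $\mathbb{R}_+=(0,\infty)$; $\mathcal{L}f(z)=\int_0^\infty f(t)e^{-zt}\,dt$ for $\mathrm{Re}\,z>0$. *)

theory Defs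
  imports "HOL-Analysis.Analysis"
begin

text \<open>
  Elements of \<open>L\<^sup>p(0,\<infinity>)\<close> are represented by total functions on the reals of which only the
  values on \<open>(0,\<infinity>)\<close> matter; functions that agree almost everywhere are not identified.
\<close>

definition Lp_pos :: "real \<Rightarrow> (real \<Rightarrow> complex) set" where
  "Lp_pos p = {f. f \<in> borel_measurable (lebesgue_on {0<..}) \<and>
                  integrable (lebesgue_on {0<..}) (\<lambda>t. norm (f t) powr p)}"

definition Lp_norm_pos :: "real \<Rightarrow> (real \<Rightarrow> complex) \<Rightarrow> real" where
  "Lp_norm_pos p f = (integral\<^sup>L (lebesgue_on {0<..}) (\<lambda>t. norm (f t) powr p)) powr (1 / p)"

definition laplace :: "(real \<Rightarrow> complex) \<Rightarrow> complex \<Rightarrow> complex" where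
  "laplace f z = integral\<^sup>L (lebesgue_on {0<..}) (\<lambda>t. f t * exp (- (z * of_real t)))"

definition max_laplace :: "(real \<Rightarrow> complex) \<Rightarrow> real \<Rightarrow> ennreal" where
  "max_laplace f y = (SUP x\<in>{0<..}. ennreal (norm (laplace f (Complex x y))))"

text \<open>Real powers of extended nonnegative reals; used for positive exponents only.\<close>

definition ennreal_powr :: "ennreal \<Rightarrow> real \<Rightarrow> ennreal" where
  "ennreal_powr x a = (if x = \<infinity> then \<infinity> else ennreal (enn2real x powr a))"

text \<open>
  The next lemmas show that the integrals involved have their usual meaning: the Bochner integral
  in \<^const>\<open>laplace\<close> is not the default value 0 of a divergent integral, and the integrand
  built from \<^const>\<open>max_laplace\<close> is measurable.
\<close>

lemma integrable_exp_pos: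
  assumes "0 < (x::real)"
  shows "integrable (lebesgue_on {0<..}) (\<lambda>t. exp (- (x * t)))"
proof -
  have "(\<lambda>t. exp (- (x * t))) absolutely_integrable_on {0..}"
    using integrable_on_exp_minus_to_infinity[OF assms, of 0]
    by (intro nonnegative_absolutely_integrable_1) auto
  then have "(\<lambda>t. exp (- (x * t))) absolutely_integrable_on {0<..}"
    by (rule set_integrable_subset) auto
  then show ?thesis
    by (simp add: integrable_restrict_space set_integrable_def)
qed

lemma laplace_integrable:
  assumes "f \<in> Lp_pos p" "1 \<le> p" "0 < Re z"
  shows "integrable (lebesgue_on {0<..}) (\<lambda>t. f t * exp (- (z * of_real t)))"
proof (rule Bochner_Integration.integrable_bound)
  show "integrable (lebesgue_on {0<..}) (\<lambda>t. norm (f t) powr p + exp (- (Re z * t)))"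
    using assms integrable_exp_pos[of "Re z"] by (auto simp: Lp_pos_def)
  have [measurable]: "f \<in> borel_measurable (lebesgue_on {0<..})"
    using assms by (auto simp: Lp_pos_def)
  have "(\<lambda>t. exp (- (z * of_real t))) \<in> borel_measurable (lebesgue_on {0<..})"
    by (rule measurable_restrict_space1, rule measurable_completion) simp
  then show "(\<lambda>t. f t * exp (- (z * of_real t))) \<in> borel_measurable (lebesgue_on {0<..})"
    by measurable
  have "norm (f t) * exp (- (Re z * t)) \<le> norm (f t) powr p + exp (- (Re z * t))"
    if "0 < t" for t
  proof (cases "norm (f t) \<le> 1")
    case True
    then have "norm (f t) * exp (- (Re z * t)) \<le> 1 * exp (- (Re z * t))"
      by (intro mult_right_mono) auto
    then show ?thesis by (smt (verit) powr_ge_zero)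
  next
    case False
    then have "norm (f t) \<le> norm (f t) powr p"
      using powr_mono[of 1 p "norm (f t)"] assms by simp
    moreover have "norm (f t) * exp (- (Re z * t)) \<le> norm (f t) * 1"
      using that assms by (intro mult_left_mono) auto
    ultimately show ?thesis by (smt (verit) exp_gt_zero)
  qed
  then show "AE t in lebesgue_on {0<..}.
      norm (f t * exp (- (z * of_real t))) \<le> norm (norm (f t) powr p + exp (- (Re z * t)))"
    by (intro AE_I2) (auto simp: norm_mult)
qed

lemma continuous_laplace_vertical:
  assumes "f \<in> Lp_pos p" "1 \<le> p" "0 < x"
  shows "continuous_on UNIV (\<lambda>y. laplace f (Complex x y))"
proof -
  have "(\<lambda>n. laplace f (Complex x (u n))) \<longlonglongrightarrow> laplace f (Complex x y)"
    if u: "u \<longlonglongrightarrow> y" for u y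
    unfolding laplace_def
  proof (rule integral_dominated_convergence
      [where w = "\<lambda>t. norm (f t * exp (- (Complex x 0 * of_real t)))"])
    show "integrable (lebesgue_on {0<..}) (\<lambda>t. norm (f t * exp (- (Complex x 0 * of_real t))))"
      using laplace_integrable[OF assms(1,2), of "Complex x 0"] assms(3)
      by (intro integrable_norm) auto
    show "AE t in lebesgue_on {0<..}.
        (\<lambda>n. f t * exp (- (Complex x (u n) * of_real t))) \<longlonglongrightarrow> f t * exp (- (Complex x y * of_real t))"
      unfolding Complex_eq by (intro AE_I2 tendsto_intros u)
  qed (use laplace_integrable[OF assms(1,2)] assms(3) in \<open>auto simp: norm_mult\<close>)
  then show ?thesis
    unfolding continuous_on_sequentially by (auto simp: o_def)
qed

lemma borel_measurable_max_laplace: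
  assumes "f \<in> Lp_pos p" "1 \<le> p"
  shows "max_laplace f \<in> borel_measurable borel"
proof (rule borel_measurableI_greater)
  fix a :: ennreal
  have "open {y. a < ennreal (norm (laplace f (Complex x y)))}" if "0 < x" for x
    using continuous_laplace_vertical[OF assms that]
    by (intro open_Collect_less continuous_on_const continuous_on_ennreal continuous_on_norm) auto
  then have "open (\<Union>x\<in>{0<..}. {y. a < ennreal (norm (laplace f (Complex x y)))})"
    by auto
  moreover have "(\<Union>x\<in>{0<..}. {y. a < ennreal (norm (laplace f (Complex x y)))})
      = {y \<in> space borel. a < max_laplace f y}"
    by (auto simp: max_laplace_def less_SUP_iff)
  ultimately show "{y \<in> space borel. a < max_laplace f y} \<in> sets borel"
    by (metis borel_open)
qed

lemma borel_measurable_ennreal_powr: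
  "(\<lambda>x. ennreal_powr x a) \<in> borel_measurable borel"
  unfolding ennreal_powr_def by measurable

end

theory Submission
  imports Defs "HOL-Complex_Analysis.Conformal_Mappings"
begin

text \<open>
  Linearize the supremum: restrict it to finitely many positive rationals, choose measurably a
  maximizer \<open>x(y)\<close>, and consider \<open>Tf(y) = \<L>f(x(y) + iy)\<close>. Trivially \<open>T\<close> maps \<open>L\<^sup>1\<close> to
  \<open>L\<^sup>\<infinity>\<close> with norm at most 1, so by Riesz--Thorin it suffices that \<open>\<parallel>T\<parallel>\<^sup>2 \<le> 32\<pi>\<close> on
  \<open>L\<^sup>2\<close>, uniformly in \<open>x(\<cdot>)\<close>. The kernel of \<open>TT\<^sup>*\<close> is \<open>1 / (x + x' + i(y - y'))\<close>; on real
  functions only its real part \<open>s / (s\<^sup>2 + (y - y')\<^sup>2)\<close>, \<open>s = x + x'\<close>, matters. This is positive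
  and at most twice the same expression with \<open>s = max x x' + a\<close>, where \<open>a > 0\<close> is a lower bound
  of \<open>x(\<cdot>)\<close>. The latter is the real part of the kernel of \<open>TU\<^sup>*\<close> or of \<open>UT\<^sup>*\<close>, where \<open>U\<close> is
  the operator for the constant function \<open>a\<close>, and Schur's test for the Poisson kernel bounds \<open>U\<close>.
  Hence \<open>\<parallel>T\<^sup>*g\<parallel>\<^sup>2 \<le> 4\<langle>U\<^sup>*g, T\<^sup>*g\<rangle>\<close> for \<open>g \<ge> 0\<close>, and \<open>\<parallel>T\<^sup>*g\<parallel>\<close> is absorbed.
\<close>

section \<open>The dual operator\<close>

lemma sigma_finite_lebesgue_on_pos: "sigma_finite_measure (lebesgue_on {0::real<..})"
proof
  have "emeasure (lebesgue_on {0<..}) {0<..real n} \<noteq> \<infinity>" for n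
    by (subst emeasure_restrict_space) (auto simp: emeasure_completion)
  moreover have "\<exists>n. t \<le> real n" for t :: real
    by (rule real_arch_simple)
  ultimately show "\<exists>A. countable A \<and> A \<subseteq> sets (lebesgue_on {0<..}) \<and>
      \<Union> A = space (lebesgue_on {0::real<..}) \<and> (\<forall>a\<in>A. emeasure (lebesgue_on {0<..}) a \<noteq> \<infinity>)"
    by (intro exI[of _ "range (\<lambda>n. {0<..real n})"])
       (auto simp: sets_restrict_space image_iff intro!: bexI[of _ "{0<..real _}"])
qed

lemma finite_measure_lborel_Icc: "finite_measure (restrict_space lborel {a..b::real})"
  by (rule finite_measureI) (simp add: emeasure_restrict_space emeasure_lborel_Icc_eq)

text \<open>The integrand is dominated by \<open>B\<close> times the tensor product of
  \<open>f\<close> and \<open>g\<close>. Every exchange of integrals below draws its joint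
  integrability from this.\<close>

lemma (in pair_sigma_finite) integrable_mult_kernel:
  fixes f g :: "_ \<Rightarrow> 'c::{real_normed_field,banach,second_countable_topology}"
  assumes [measurable]: "(\<lambda>(x, y). k x y) \<in> borel_measurable (M1 \<Otimes>\<^sub>M M2)"
    and f: "integrable M1 f" and g: "integrable M2 g"
    and k: "\<And>x y. x \<in> space M1 \<Longrightarrow> y \<in> space M2 \<Longrightarrow> norm (k x y) \<le> B"
  shows "integrable (M1 \<Otimes>\<^sub>M M2) (\<lambda>(x, y). f x * g y * k x y)"
proof -
  note [measurable] = borel_measurable_integrable[OF f] borel_measurable_integrable[OF g]
  have "integrable (M1 \<Otimes>\<^sub>M M2) (\<lambda>(x, y). f x * g y)"
  proof (rule Fubini_integrable)
    show "integrable M1 (\<lambda>x. \<integral>y. norm (case (x, y) of (x, y) \<Rightarrow> f x * g y) \<partial>M2)"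
      using integrable_norm[OF f] by (simp add: norm_mult)
    show "AE x in M1. integrable M2 (\<lambda>y. case (x, y) of (x, y) \<Rightarrow> f x * g y)"
      using g by simp
  qed simp
  then have "integrable (M1 \<Otimes>\<^sub>M M2) (\<lambda>z. B * norm ((\<lambda>(x, y). f x * g y) z))"
    by (intro integrable_mult_right integrable_norm)
  then show ?thesis
  proof (rule Bochner_Integration.integrable_bound)
    have "norm (f x * g y * k x y) \<le> B * norm (f x * g y)"
      if "x \<in> space M1" "y \<in> space M2" for x y
      using mult_right_mono[OF k[OF that], of "norm (f x * g y)"]
      by (simp add: norm_mult mult_ac)
    then show "AE z in M1 \<Otimes>\<^sub>M M2. norm (case z of (x, y) \<Rightarrow> f x * g y * k x y)
        \<le> norm (B * norm (case z of (x, y) \<Rightarrow> f x * g y))"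
      by (intro AE_I2) (force simp: space_pair_measure intro: order_trans[OF _ abs_ge_self])
  qed simp
qed

text \<open>On \<open>complex\<close> as a real vector space, \<open>u \<bullet> v\<close> is the
  real part of \<open>u * cnj v\<close>. It is real bilinear, so both integrals can be pulled out;
  this gives direct access to the real part of the kernel of the composition of T with its
  adjoint.\<close>

lemma (in sigma_finite_measure) inner_integral_integral:
  fixes u v :: "_ \<Rightarrow> complex"
  assumes u: "integrable M u" and v: "integrable M v"
  shows "(\<integral>x. u x \<partial>M) \<bullet> (\<integral>y. v y \<partial>M) = (\<integral>(x, y). u x \<bullet> v y \<partial>(M \<Otimes>\<^sub>M M))"
    and "integrable (M \<Otimes>\<^sub>M M) (\<lambda>(x, y). u x \<bullet> v y)"
proof -
  interpret P: pair_sigma_finite M M ..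
  note [measurable] = borel_measurable_integrable[OF u] borel_measurable_integrable[OF v]
  show int: "integrable (M \<Otimes>\<^sub>M M) (\<lambda>(x, y). u x \<bullet> v y)"
  proof (rule Bochner_Integration.integrable_bound)
    show "integrable (M \<Otimes>\<^sub>M M) (\<lambda>(x, y). norm (u x) * norm (v y) * (1::real))"
      using integrable_norm[OF u] integrable_norm[OF v]
      by (intro P.integrable_mult_kernel[where B = 1]) auto
    show "AE z in M \<Otimes>\<^sub>M M. norm (case z of (x, y) \<Rightarrow> u x \<bullet> v y)
        \<le> norm (case z of (x, y) \<Rightarrow> norm (u x) * norm (v y) * 1)"
      by (intro AE_I2) (auto simp: Cauchy_Schwarz_ineq2)
  qed simp
  have "(\<integral>x. u x \<partial>M) \<bullet> (\<integral>y. v y \<partial>M) = (\<integral>x. (\<integral>y. u x \<bullet> v y \<partial>M) \<partial>M)"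
    using u v by simp
  also have "\<dots> = (\<integral>(x, y). u x \<bullet> v y \<partial>(M \<Otimes>\<^sub>M M))"
    using P.integral_fst[OF int] by simp
  finally show "(\<integral>x. u x \<partial>M) \<bullet> (\<integral>y. v y \<partial>M) = (\<integral>(x, y). u x \<bullet> v y \<partial>(M \<Otimes>\<^sub>M M))" .
qed

section \<open>Two explicit integrals: the Laplace transform of the cosine and the mass of the
  Poisson kernel\<close>

text \<open>The real part of 1 / (s + i d). The explicit antiderivative \<open>?F\<close> is
  evaluated on \<open>{0..n}\<close>, and n tends to infinity with \<open>exp (- (s * t))\<close> as
  majorant.\<close>

lemma integral_exp_cos:
  assumes "0 < s"
  shows "(\<integral>t. exp (- (s * t)) * cos (d * t) \<partial>lebesgue_on {0::real<..}) = s / (s\<^sup>2 + d\<^sup>2)"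
proof -
  let ?f = "\<lambda>t. exp (- (s * t)) * cos (d * t)"
  let ?F = "\<lambda>t. exp (- (s * t)) * (d * sin (d * t) - s * cos (d * t)) / (s\<^sup>2 + d\<^sup>2)"
  have pos: "0 < s\<^sup>2 + d\<^sup>2"
    using assms by (simp add: add_pos_nonneg)
  have [measurable]: "?f \<in> borel_measurable (lebesgue_on {0<..})"
    by (rule measurable_restrict_space1, rule measurable_completion) simp
  have "(\<lambda>n. \<integral>t. indicat_real {0..real n} t * ?f t \<partial>lebesgue_on {0::real<..})
      \<longlonglongrightarrow> (\<integral>t. ?f t \<partial>lebesgue_on {0::real<..})"
  proof (rule integral_dominated_convergence[OF _ _ integrable_exp_pos[OF assms]])
    show "AE t in lebesgue_on {0::real<..}. (\<lambda>n. indicat_real {0..real n} t * ?f t) \<longlonglongrightarrow> ?f t"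
    proof (intro AE_I2 tendsto_eventually)
      fix t :: real assume "t \<in> space (lebesgue_on {0<..})"
      then show "\<forall>\<^sub>F n in sequentially. indicat_real {0..real n} t * ?f t = ?f t"
        using eventually_ge_at_top[of "nat \<lceil>t\<rceil>"]
        by (auto elim!: eventually_mono simp: indicator_def)
    qed
    show "AE t in lebesgue_on {0<..}. norm (indicat_real {0..real n} t * ?f t) \<le> exp (- (s * t))" for n
      by (intro AE_I2) (auto simp: abs_mult indicator_def)
    show "(\<lambda>t. indicat_real {0..real n} t * ?f t) \<in> borel_measurable (lebesgue_on {0<..})" for n
      by (rule measurable_restrict_space1, rule measurable_completion) simp
  qed simp
  moreover have "(\<integral>t. indicat_real {0..real n} t * ?f t \<partial>lebesgue_on {0::real<..}) = ?F n - ?F 0" for n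
  proof -
    have "(\<integral>t. indicat_real {0..real n} t * ?f t \<partial>lebesgue_on {0::real<..})
        = (\<integral>t. indicat_real {0<..real n} t *\<^sub>R ?f t \<partial>lebesgue)"
      by (subst integral_restrict_space)
         (auto intro!: Bochner_Integration.integral_cong simp: indicator_def)
    \<comment> \<open>The fundamental theorem needs the closed interval; the added point 0 is a null
      set.\<close>
    also have "\<dots> = (\<integral>t. indicat_real {0..real n} t *\<^sub>R ?f t \<partial>lebesgue)"
    proof (rule integral_cong_AE)
      have "AE t in lebesgue. t \<noteq> (0::real)"
        by (rule AE_completion) (rule AE_lborel_singleton)
      then show "AE t in lebesgue. indicat_real {0<..real n} t *\<^sub>R ?f t = indicat_real {0..real n} t *\<^sub>R ?f t"
        by eventually_elim (auto simp: indicator_def)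
    qed (rule measurable_completion, simp)+
    also have "\<dots> = (\<integral>t. indicat_real {0..real n} t *\<^sub>R ?f t \<partial>lborel)"
      by (rule integral_completion) simp
    also have "\<dots> = ?F n - ?F 0"
    proof (rule integral_FTC_atLeastAtMost)
      fix t :: real
      have "(?F has_real_derivative ?f t) (at t)"
      proof -
        have "((\<lambda>t. exp (- (s * t)) * (d * sin (d * t) - s * cos (d * t)))
            has_real_derivative (s\<^sup>2 + d\<^sup>2) * ?f t) (at t)"
          by (auto intro!: derivative_eq_intros simp: algebra_simps power2_eq_square)
        from DERIV_cdivide[OF this, of "s\<^sup>2 + d\<^sup>2"] show ?thesis
          using assms by simp
      qed
      then show "(?F has_vector_derivative ?f t) (at t within {0..real n})"
        by (simp add: has_real_derivative_iff_has_vector_derivative has_vector_derivative_at_within)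
    qed (auto intro!: continuous_intros)
    finally show ?thesis .
  qed
  moreover have "(\<lambda>n. ?F (real n) - ?F 0) \<longlonglongrightarrow> 0 - ?F 0"
  proof (intro tendsto_diff tendsto_const)
    have "(\<lambda>n. exp (- (s * real n)) * ((\<bar>d\<bar> + s) / (s\<^sup>2 + d\<^sup>2))) \<longlonglongrightarrow> 0 * ((\<bar>d\<bar> + s) / (s\<^sup>2 + d\<^sup>2))"
    proof (intro tendsto_mult tendsto_const)
      have "filterlim (\<lambda>n. s * real n) at_top sequentially"
        using filterlim_tendsto_pos_mult_at_top[OF tendsto_const assms filterlim_real_sequentially] .
      then show "(\<lambda>n. exp (- (s * real n))) \<longlonglongrightarrow> 0"
        by (intro filterlim_compose[OF exp_at_bot] filterlim_compose[OF filterlim_uminus_at_bot_at_top])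
    qed
    then have "(\<lambda>n. exp (- (s * real n)) * ((\<bar>d\<bar> + s) / (s\<^sup>2 + d\<^sup>2))) \<longlonglongrightarrow> 0"
      by simp
    then show "(\<lambda>n. ?F (real n)) \<longlonglongrightarrow> 0"
    proof (rule Lim_null_comparison[rotated])
      have "\<bar>d * sin (d * t) - s * cos (d * t)\<bar> \<le> \<bar>d\<bar> + s" for t
      proof -
        have "\<bar>d * sin (d * t)\<bar> \<le> \<bar>d\<bar> * 1" "\<bar>s * cos (d * t)\<bar> \<le> s * 1"
          using assms unfolding abs_mult by (intro mult_mono; simp)+
        then show ?thesis by linarith
      qed
      then show "\<forall>\<^sub>F n in sequentially. norm (?F (real n)) \<le> exp (- (s * real n)) * ((\<bar>d\<bar> + s) / (s\<^sup>2 + d\<^sup>2))"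
        using pos by (intro always_eventually allI) (simp add: abs_mult divide_right_mono)
    qed
  qed
  ultimately have "(\<lambda>n. ?F (real n) - ?F 0) \<longlonglongrightarrow> (\<integral>t. ?f t \<partial>lebesgue_on {0::real<..})"
    and "(\<lambda>n. ?F (real n) - ?F 0) \<longlonglongrightarrow> 0 - ?F 0"
    by simp_all
  then have "(\<integral>t. ?f t \<partial>lebesgue_on {0::real<..}) = 0 - ?F 0"
    by (rule LIMSEQ_unique)
  then show "(\<integral>t. ?f t \<partial>lebesgue_on {0::real<..}) = s / (s\<^sup>2 + d\<^sup>2)"
    by simp
qed

text \<open>The antiderivative is an arctangent, whose total variation is pi whatever the scale
  \<open>c\<close> is. This independence of \<open>c\<close> makes the L^2 bound uniform in the
  lower bound of \<open>x\<close>.\<close>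

lemma integral_poisson_le:
  assumes "0 < c"
  shows "(\<integral>u. c / (c\<^sup>2 + (v - u)\<^sup>2) \<partial>restrict_space lborel {a..b}) \<le> pi"
proof (cases "a \<le> b")
  case True
  have pos: "0 < c\<^sup>2 + (v - u)\<^sup>2" for u
    using assms by (simp add: add_pos_nonneg)
  have "(\<integral>u. c / (c\<^sup>2 + (v - u)\<^sup>2) \<partial>restrict_space lborel {a..b})
      = (\<integral>u. indicat_real {a..b} u *\<^sub>R (c / (c\<^sup>2 + (v - u)\<^sup>2)) \<partial>lborel)"
    by (subst integral_restrict_space) auto
  also have "\<dots> = arctan ((b - v) / c) - arctan ((a - v) / c)"
  proof (rule integral_FTC_atLeastAtMost[OF True])
    fix u
    have "((\<lambda>u. arctan ((u - v) / c)) has_real_derivative c / (c\<^sup>2 + (v - u)\<^sup>2)) (at u)"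
      using assms pos[of u]
      by (auto intro!: derivative_eq_intros simp: divide_simps) (simp add: power2_eq_square algebra_simps)
    then show "((\<lambda>u. arctan ((u - v) / c)) has_vector_derivative c / (c\<^sup>2 + (v - u)\<^sup>2)) (at u within {a..b})"
      by (simp add: has_real_derivative_iff_has_vector_derivative has_vector_derivative_at_within)
  qed (intro continuous_intros ballI pos[THEN less_imp_neq, symmetric])
  also have "\<dots> \<le> pi"
    using arctan_ubound[of "(b - v) / c"] arctan_lbound[of "(a - v) / c"] by linarith
  finally show ?thesis .
next
  case False
  then have "space (restrict_space lborel {a..b}) = {}"
    by simp
  then show ?thesis
    by (simp add: Bochner_Integration.integral_empty)
qed

section \<open>The linearized kernel and its transpose\<close>

text \<open>Kernel of the linearized operator T: integrating f against it in \<open>t\<close> gives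
  the Laplace transform of f at the point x(y) + iy.\<close>

definition vkernel :: "(real \<Rightarrow> real) \<Rightarrow> real \<Rightarrow> real \<Rightarrow> complex" where
  "vkernel x t y = exp (- (Complex (x y) y * of_real t))"

lemma norm_vkernel: "norm (vkernel x t y) = exp (- (x y * t))"
  by (simp add: vkernel_def)

text \<open>Multiplying one exponential by the conjugate of the other adds the real parts and
  subtracts the imaginary ones; the inner product keeps the cosine.\<close>

lemma inner_vkernel:
  "vkernel x1 t y \<bullet> vkernel x2 t y' = exp (- ((x1 y + x2 y') * t)) * cos ((y - y') * t)"
proof -
  have "vkernel x1 t y \<bullet> vkernel x2 t y' =
      exp (- (x1 y * t)) * exp (- (x2 y' * t)) * cos (y * t - y' * t)"
    unfolding vkernel_def inner_complex_def Re_exp Im_exp cos_diff by (simp add: algebra_simps)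
  then show ?thesis
    by (simp add: left_diff_distrib distrib_right flip: exp_add)
qed

lemma measurable_vkernel [measurable]:
  assumes [measurable]: "x \<in> borel_measurable borel"
  shows "(\<lambda>(t, y). vkernel x t y)
    \<in> borel_measurable (lebesgue_on {0<..} \<Otimes>\<^sub>M restrict_space lborel {b..c})"
proof -
  have [measurable]: "(\<lambda>t. t) \<in> borel_measurable (lebesgue_on {0::real<..})"
    by (rule measurable_restrict_space1, rule measurable_completion) simp
  have [measurable]: "(\<lambda>y. y) \<in> borel_measurable (restrict_space lborel {b..c})"
    "x \<in> borel_measurable (restrict_space lborel {b..c})"
    by (rule measurable_restrict_space1, simp)+
  show ?thesis
    unfolding vkernel_def Complex_eq by measurable
qed

lemma measurable_vkernel_snd [measurable]:
  assumes [measurable]: "x \<in> borel_measurable borel"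
  shows "vkernel x t \<in> borel_measurable (restrict_space lborel {b..c})"
  unfolding vkernel_def Complex_eq by (rule measurable_restrict_space1) measurable

lemma integrable_vkernel:
  assumes "x \<in> borel_measurable borel" "\<And>y. 0 \<le> x y" "0 < t"
    and g: "integrable (restrict_space lborel {b..c}) (g :: real \<Rightarrow> complex)"
  shows "integrable (restrict_space lborel {b..c}) (\<lambda>y. g y * vkernel x t y)"
proof (rule Bochner_Integration.integrable_bound[OF g])
  note [measurable] = assms(1) borel_measurable_integrable[OF g]
  show "(\<lambda>y. g y * vkernel x t y) \<in> borel_measurable (restrict_space lborel {b..c})"
    by measurable
  show "AE y in restrict_space lborel {b..c}. norm (g y * vkernel x t y) \<le> norm (g y)"
    using assms(2,3) by (intro AE_I2) (simp add: norm_mult norm_vkernel mult_left_le)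
qed

text \<open>The transpose of T for the bilinear pairing without conjugation; on real
  \<open>g\<close> it is the complex conjugate of the Hilbert space adjoint, so the norms agree. The
  window \<open>{b..c}\<close> makes the measure in \<open>y\<close> finite.\<close>

definition dual_laplace :: "real \<Rightarrow> real \<Rightarrow> (real \<Rightarrow> real) \<Rightarrow> (real \<Rightarrow> complex) \<Rightarrow> real \<Rightarrow> complex" where
  "dual_laplace b c x g t = (\<integral>y. g y * vkernel x t y \<partial>restrict_space lborel {b..c})"

text \<open>Fubini in t, y and y', followed by \<open>integral_exp_cos\<close> in t. The two height
  functions are kept apart because one of them will be the constant \<open>a\<close>.\<close>

lemma dual_laplace_inner:
  fixes g h :: "real \<Rightarrow> real"
  assumes a: "0 < a" and x1: "\<And>y. a \<le> x1 y" and x2: "\<And>y. a \<le> x2 y"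
    and [measurable]: "x1 \<in> borel_measurable borel" "x2 \<in> borel_measurable borel"
    and g: "integrable (restrict_space lborel {b..c}) g"
    and h: "integrable (restrict_space lborel {b..c}) h"
  defines "N \<equiv> restrict_space lborel {b..c}"
  defines "V \<equiv> dual_laplace b c"
  shows "(\<integral>t. V x1 g t \<bullet> V x2 h t \<partial>lebesgue_on {0<..}) =
      (\<integral>(y, y'). g y * h y' * ((x1 y + x2 y') / ((x1 y + x2 y')\<^sup>2 + (y - y')\<^sup>2)) \<partial>(N \<Otimes>\<^sub>M N))"
    and "integrable (lebesgue_on {0<..}) (\<lambda>t. V x1 g t \<bullet> V x2 h t)"
    and "integrable (N \<Otimes>\<^sub>M N)
      (\<lambda>(y, y'). g y * h y' * ((x1 y + x2 y') / ((x1 y + x2 y')\<^sup>2 + (y - y')\<^sup>2)))"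
proof -
  let ?M = "lebesgue_on {0::real<..}"
  let ?K = "\<lambda>t y y'. exp (- ((x1 y + x2 y') * t)) * cos ((y - y') * t)"
  interpret M: sigma_finite_measure ?M
    by (rule sigma_finite_lebesgue_on_pos)
  interpret N: finite_measure N
    unfolding N_def by (rule finite_measure_lborel_Icc)
  interpret NN: pair_sigma_finite N N ..
  interpret P: pair_sigma_finite ?M "N \<Otimes>\<^sub>M N" ..
  have [measurable]: "(\<lambda>t. t) \<in> borel_measurable ?M"
    by (rule measurable_restrict_space1, rule measurable_completion) simp
  have [measurable]: "(\<lambda>y. y) \<in> borel_measurable N"
    "x1 \<in> borel_measurable N" "x2 \<in> borel_measurable N"
    unfolding N_def by (rule measurable_restrict_space1, simp)+
  note gh = g[folded N_def] h[folded N_def]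
  have V: "V x1 g t \<bullet> V x2 h t = (\<integral>(y, y'). g y * h y' * ?K t y y' \<partial>(N \<Otimes>\<^sub>M N))" if "0 < t" for t
  proof -
    have "integrable N (\<lambda>y. complex_of_real (g y) * vkernel x1 t y)"
      "integrable N (\<lambda>y. complex_of_real (h y) * vkernel x2 t y)"
      using a x1 x2 that gh unfolding N_def
      by (auto intro!: integrable_vkernel intro: order_trans[OF less_imp_le[OF a]])
    from N.inner_integral_integral(1)[OF this] show ?thesis
      by (simp add: V_def dual_laplace_def N_def inner_vkernel mult_ac
          flip: scaleR_conv_of_real)
  qed
  have int2: "integrable (N \<Otimes>\<^sub>M N) (\<lambda>(y, y'). g y * h y' * 1)"
    using gh by (intro NN.integrable_mult_kernel[where B = 1]) auto
  \<comment> \<open>Splitting off \<open>exp (- (2 * a * t))\<close> supplies a factor integrable in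
    t; what remains is bounded by 1 because both heights are at least \<open>a\<close>.\<close>
  have "integrable (?M \<Otimes>\<^sub>M (N \<Otimes>\<^sub>M N)) (\<lambda>(t, z). exp (- (2 * a * t)) * (case z of (y, y') \<Rightarrow> g y * h y' * 1)
      * (case z of (y, y') \<Rightarrow> exp (- ((x1 y + x2 y' - 2 * a) * t)) * cos ((y - y') * t)))"
  proof (rule P.integrable_mult_kernel[where B = 1, OF _ _ int2])
    show "integrable ?M (\<lambda>t. exp (- (2 * a * t)))"
      using a by (intro integrable_exp_pos) simp
    show "norm (case z of (y, y') \<Rightarrow> exp (- ((x1 y + x2 y' - 2 * a) * t)) * cos ((y - y') * t)) \<le> 1"
      if "t \<in> space ?M" for t z
    proof (cases z)
      case (Pair y y')
      have "exp (- ((x1 y + x2 y' - 2 * a) * t)) * \<bar>cos ((y - y') * t)\<bar> \<le> 1 * 1"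
        using that x1[of y] x2[of y'] by (intro mult_mono) auto
      then show ?thesis
        by (simp add: Pair abs_mult)
    qed
  qed simp
  then have int3: "integrable (?M \<Otimes>\<^sub>M (N \<Otimes>\<^sub>M N)) (\<lambda>(t, z). case z of (y, y') \<Rightarrow> g y * h y' * ?K t y y')"
    by (rule Bochner_Integration.integrable_cong[THEN iffD1, rotated -1])
       (auto simp: algebra_simps simp flip: exp_add)
  have R: "(\<integral>t. (case z of (y, y') \<Rightarrow> g y * h y' * ?K t y y') \<partial>?M) =
      (case z of (y, y') \<Rightarrow> g y * h y' * ((x1 y + x2 y') / ((x1 y + x2 y')\<^sup>2 + (y - y')\<^sup>2)))" for z
  proof (cases z)
    case (Pair y y')
    have "0 < x1 y + x2 y'"
      using a x1[of y] x2[of y'] by linarith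
    then show ?thesis
      using integral_exp_cos[of "x1 y + x2 y'" "y - y'"] by (simp add: Pair)
  qed
  have "integrable ?M (\<lambda>t. \<integral>z. (case z of (y, y') \<Rightarrow> g y * h y' * ?K t y y') \<partial>(N \<Otimes>\<^sub>M N))"
    by (rule P.integrable_fst[OF int3])
  then show "integrable ?M (\<lambda>t. V x1 g t \<bullet> V x2 h t)"
    by (rule Bochner_Integration.integrable_cong[THEN iffD1, rotated -1]) (auto simp: V)
  show "integrable (N \<Otimes>\<^sub>M N)
      (\<lambda>(y, y'). g y * h y' * ((x1 y + x2 y') / ((x1 y + x2 y')\<^sup>2 + (y - y')\<^sup>2)))"
    using P.integrable_snd[OF int3] unfolding R .
  have "(\<integral>t. V x1 g t \<bullet> V x2 h t \<partial>?M)
      = (\<integral>t. (\<integral>z. (case z of (y, y') \<Rightarrow> g y * h y' * ?K t y y') \<partial>(N \<Otimes>\<^sub>M N)) \<partial>?M)"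
    by (rule Bochner_Integration.integral_cong) (auto simp: V)
  also have "\<dots> = (\<integral>z. (\<integral>t. (case z of (y, y') \<Rightarrow> g y * h y' * ?K t y y') \<partial>?M) \<partial>(N \<Otimes>\<^sub>M N))"
    using P.integral_fst[OF int3] P.integral_snd[OF int3] by simp
  finally show "(\<integral>t. V x1 g t \<bullet> V x2 h t \<partial>?M) =
      (\<integral>(y, y'). g y * h y' * ((x1 y + x2 y') / ((x1 y + x2 y')\<^sup>2 + (y - y')\<^sup>2)) \<partial>(N \<Otimes>\<^sub>M N))"
    unfolding R .
qed

section \<open>The estimate in \<open>L\<^sup>2\<close>\<close>

text \<open>Schur's test with constant weight: the symmetric positive kernel has row integrals at
  most pi, so its quadratic form is bounded by pi.\<close>

lemma poisson_form_le:
  fixes g :: "real \<Rightarrow> real" and b c :: real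
  defines "N \<equiv> restrict_space lborel {b..c}"
  assumes s: "0 < s" and g: "integrable N g" and g2: "integrable N (\<lambda>y. (g y)\<^sup>2)"
    and int: "integrable (N \<Otimes>\<^sub>M N) (\<lambda>(y, y'). g y * g y' * (s / (s\<^sup>2 + (y - y')\<^sup>2)))"
  shows "(\<integral>(y, y'). g y * g y' * (s / (s\<^sup>2 + (y - y')\<^sup>2)) \<partial>(N \<Otimes>\<^sub>M N)) \<le> pi * (\<integral>y. (g y)\<^sup>2 \<partial>N)"
proof -
  let ?P = "\<lambda>y y'. s / (s\<^sup>2 + (y - y')\<^sup>2)"
  interpret N: finite_measure N
    unfolding N_def by (rule finite_measure_lborel_Icc)
  interpret NN: pair_sigma_finite N N ..
  have [measurable]: "(\<lambda>y. y) \<in> borel_measurable N"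
    unfolding N_def by (rule measurable_restrict_space1, simp)
  \<comment> \<open>A crude bound depending on \<open>s\<close>; it serves only to justify
    integrability and does not enter the final constant.\<close>
  have P: "norm (?P y y') \<le> 1 / s" for y y'
  proof -
    have "s * s \<le> s\<^sup>2 + (y - y')\<^sup>2"
      by (simp add: power2_eq_square)
    then show ?thesis
      using s by (simp add: divide_simps) (metis not_sum_power2_lt_zero)
  qed
  have 1: "integrable (N \<Otimes>\<^sub>M N) (\<lambda>(y, y'). (g y)\<^sup>2 * 1 * ?P y y')"
    using g2 P by (intro NN.integrable_mult_kernel[where B = "1 / s"]) auto
  have 2: "integrable (N \<Otimes>\<^sub>M N) (\<lambda>(y, y'). 1 * (g y')\<^sup>2 * ?P y y')"
    using g2 P by (intro NN.integrable_mult_kernel[where B = "1 / s"]) auto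
  have le: "(\<integral>y. (g y)\<^sup>2 * (\<integral>y'. ?P y y' \<partial>N) \<partial>N) \<le> (\<integral>y. (g y)\<^sup>2 * pi \<partial>N)"
  proof (rule integral_mono)
    show "integrable N (\<lambda>y. (g y)\<^sup>2 * (\<integral>y'. ?P y y' \<partial>N))"
      using NN.integrable_fst[OF 1] by (simp del: times_divide_eq_right)
    show "(g y)\<^sup>2 * (\<integral>y'. ?P y y' \<partial>N) \<le> (g y)\<^sup>2 * pi" for y
      unfolding N_def by (intro mult_left_mono integral_poisson_le[OF s]) simp
  qed (use g2 in simp)
  \<comment> \<open>The product \<open>g y * g y'\<close> is replaced by half the sum of the
    squares, so that one variable can be integrated out in each term.\<close>
  have "(\<integral>(y, y'). g y * g y' * ?P y y' \<partial>(N \<Otimes>\<^sub>M N))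
      \<le> (\<integral>z. (case z of (y, y') \<Rightarrow> (g y)\<^sup>2 * 1 * ?P y y') / 2 + (case z of (y, y') \<Rightarrow> 1 * (g y')\<^sup>2 * ?P y y') / 2 \<partial>(N \<Otimes>\<^sub>M N))"
  proof (rule integral_mono[OF int])
    show "integrable (N \<Otimes>\<^sub>M N) (\<lambda>z. (case z of (y, y') \<Rightarrow> (g y)\<^sup>2 * 1 * ?P y y') / 2 + (case z of (y, y') \<Rightarrow> 1 * (g y')\<^sup>2 * ?P y y') / 2)"
      using 1 2 by (intro Bochner_Integration.integrable_add integrable_divide)
    have "g y * g y' * ?P y y' \<le> (g y)\<^sup>2 * 1 * ?P y y' / 2 + 1 * (g y')\<^sup>2 * ?P y y' / 2" for y y'
    proof -
      have "g y * g y' \<le> ((g y)\<^sup>2 + (g y')\<^sup>2) / 2"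
        using sum_squares_bound[of "g y" "g y'"] by simp
      then have "g y * g y' * ?P y y' \<le> ((g y)\<^sup>2 + (g y')\<^sup>2) / 2 * ?P y y'"
        using s by (intro mult_right_mono) auto
      also have "\<dots> = (g y)\<^sup>2 * 1 * ?P y y' / 2 + 1 * (g y')\<^sup>2 * ?P y y' / 2"
        by (simp only: add_divide_distrib distrib_right mult_1_left mult_1_right times_divide_eq_left)
      finally show ?thesis .
    qed
    then show "(case z of (y, y') \<Rightarrow> g y * g y' * ?P y y') \<le>
        (case z of (y, y') \<Rightarrow> (g y)\<^sup>2 * 1 * ?P y y') / 2 + (case z of (y, y') \<Rightarrow> 1 * (g y')\<^sup>2 * ?P y y') / 2" for z
      by (cases z) (simp only: prod.case)
  qed
  also have "\<dots> = (\<integral>(y, y'). (g y)\<^sup>2 * 1 * ?P y y' \<partial>(N \<Otimes>\<^sub>M N)) / 2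
      + (\<integral>(y, y'). 1 * (g y')\<^sup>2 * ?P y y' \<partial>(N \<Otimes>\<^sub>M N)) / 2"
    using 1 2 by (subst Bochner_Integration.integral_add) (auto intro!: integrable_divide)
  also have "(\<integral>(y, y'). (g y)\<^sup>2 * 1 * ?P y y' \<partial>(N \<Otimes>\<^sub>M N)) = (\<integral>y. (g y)\<^sup>2 * (\<integral>y'. ?P y y' \<partial>N) \<partial>N)"
    by (subst NN.integral_fst[OF 1, symmetric]) (simp del: times_divide_eq_right)
  \<comment> \<open>By symmetry of the kernel, integrating out the first variable yields the same
    expression.\<close>
  also have "(\<integral>(y, y'). 1 * (g y')\<^sup>2 * ?P y y' \<partial>(N \<Otimes>\<^sub>M N)) = (\<integral>y. (g y)\<^sup>2 * (\<integral>y'. ?P y y' \<partial>N) \<partial>N)"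
    by (subst NN.integral_snd[OF 2, symmetric]) (simp add: power2_commute del: times_divide_eq_right)
  finally show ?thesis
    using le by (simp add: mult.commute)
qed

text \<open>After cross-multiplication, \<open>r \<le> 2 * s\<close> handles the terms without
  \<open>d\<close> and \<open>s \<le> 2 * r\<close> those with \<open>d\<^sup>2\<close>.\<close>

lemma poisson_kernel_comparable:
  assumes "0 < s" "0 < r" "s \<le> 2 * r" "r \<le> 2 * s"
  shows "s / (s\<^sup>2 + d\<^sup>2) \<le> 2 * (r / (r\<^sup>2 + (d::real)\<^sup>2))"
proof -
  have "s * (r * r) \<le> s * (r * (2 * s))" "s * d\<^sup>2 \<le> 2 * r * d\<^sup>2"
    using assms by (intro mult_left_mono mult_right_mono; simp)+
  then have "s * (r\<^sup>2 + d\<^sup>2) \<le> 2 * r * (s\<^sup>2 + d\<^sup>2)"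
    by (simp add: algebra_simps power2_eq_square)
  moreover have "0 < s\<^sup>2 + d\<^sup>2" "0 < r\<^sup>2 + d\<^sup>2"
    using assms by (simp_all add: add_pos_nonneg)
  ultimately show ?thesis
    by (simp add: divide_simps mult_ac)
qed

text \<open>If x is the larger height, then \<open>x + a \<le> x + x' \<le> 2 * (x + a)\<close>, so
  the first summand alone suffices, and symmetrically otherwise. A sum is used instead of a case
  distinction because each summand is again the kernel of an inner product of two
  transposes.\<close>

lemma poisson_kernel_split:
  assumes "0 < a" "a \<le> x" "a \<le> x'"
  shows "(x + x') / ((x + x')\<^sup>2 + d\<^sup>2) \<le>
    2 * ((x + a) / ((x + a)\<^sup>2 + d\<^sup>2)) + 2 * ((a + x') / ((a + x')\<^sup>2 + (d::real)\<^sup>2))"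
proof (cases "x' \<le> x")
  case True
  have "0 \<le> 2 * ((a + x') / ((a + x')\<^sup>2 + d\<^sup>2))"
    using assms by simp
  moreover have "(x + x') / ((x + x')\<^sup>2 + d\<^sup>2) \<le> 2 * ((x + a) / ((x + a)\<^sup>2 + d\<^sup>2))"
    using True assms by (intro poisson_kernel_comparable) auto
  ultimately show ?thesis
    by linarith
next
  case False
  have "0 \<le> 2 * ((x + a) / ((x + a)\<^sup>2 + d\<^sup>2))"
    using assms by simp
  moreover have "(x + x') / ((x + x')\<^sup>2 + d\<^sup>2) \<le> 2 * ((a + x') / ((a + x')\<^sup>2 + d\<^sup>2))"
    using False assms by (intro poisson_kernel_comparable) auto
  ultimately show ?thesis
    by linarith
qed

text \<open>Let X and Y be the squared L^2 norms of \<open>?V\<close> and \<open>?U\<close>. The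
  kernel inequality, multiplied by the nonnegative \<open>g y * g y'\<close>, gives X \<le> 4
  \<langle>U, V\<rangle> \<le> X/2 + 8 Y. As X is finite, it can be absorbed: X \<le> 16 Y, and Y is
  at most pi times the squared norm of \<open>g\<close>.\<close>

lemma dual_laplace_L2_nonneg:
  fixes g :: "real \<Rightarrow> real" and b c :: real
  defines "N \<equiv> restrict_space lborel {b..c}"
  assumes a: "0 < a" and x: "\<And>y. a \<le> x y" and x_meas: "x \<in> borel_measurable borel"
    and g: "integrable N g" and g2: "integrable N (\<lambda>y. (g y)\<^sup>2)" and g_nonneg: "\<And>y. 0 \<le> g y"
  shows "(\<integral>t. (norm (dual_laplace b c x g t))\<^sup>2 \<partial>lebesgue_on {0<..}) \<le> 16 * pi * (\<integral>y. (g y)\<^sup>2 \<partial>N)"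
proof -
  let ?M = "lebesgue_on {0::real<..}"
  let ?R = "\<lambda>x1 x2 z. case z of (y, y') \<Rightarrow>
      g y * g y' * ((x1 y + x2 y') / ((x1 y + x2 y')\<^sup>2 + (y - y')\<^sup>2))"
  let ?e = "\<lambda>_::real. a"
  let ?V = "dual_laplace b c x g" and ?U = "dual_laplace b c ?e g"
  have e: "?e \<in> borel_measurable borel"
    by simp
  note form = dual_laplace_inner[OF a _ _ _ _ g[unfolded N_def] g[unfolded N_def], folded N_def]
  note VV = form[of x x, OF x x x_meas x_meas]
  note VU = form[of x ?e, OF x order_refl x_meas e]
  note UV = form[of ?e x, OF order_refl x e x_meas]
  note UU = form[of ?e ?e, OF order_refl order_refl e e]
  \<comment> \<open>For the constant height \<open>a\<close> the form is exactly the Poisson form at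
    scale \<open>a + a\<close>.\<close>
  have Y: "(\<integral>t. ?U t \<bullet> ?U t \<partial>?M) \<le> pi * (\<integral>y. (g y)\<^sup>2 \<partial>N)"
    using poisson_form_le[of "a + a" b c g] UU a g g2 by (simp add: N_def)
  have "(\<integral>t. ?V t \<bullet> ?V t \<partial>?M) = (\<integral>z. ?R x x z \<partial>(N \<Otimes>\<^sub>M N))"
    by (rule VV(1))
  also have "\<dots> \<le> (\<integral>z. 2 * ?R x ?e z + 2 * ?R ?e x z \<partial>(N \<Otimes>\<^sub>M N))"
  proof (rule integral_mono[OF VV(3)])
    show "integrable (N \<Otimes>\<^sub>M N) (\<lambda>z. 2 * ?R x ?e z + 2 * ?R ?e x z)"
      by (intro Bochner_Integration.integrable_add integrable_mult_right VU(3) UV(3))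
    show "?R x x z \<le> 2 * ?R x ?e z + 2 * ?R ?e x z" for z
    proof (cases z)
      case (Pair y y')
      have "g y * g y' * ((x y + x y') / ((x y + x y')\<^sup>2 + (y - y')\<^sup>2)) \<le> g y * g y' *
        (2 * ((x y + a) / ((x y + a)\<^sup>2 + (y - y')\<^sup>2)) + 2 * ((a + x y') / ((a + x y')\<^sup>2 + (y - y')\<^sup>2)))"
        by (intro mult_left_mono poisson_kernel_split a x mult_nonneg_nonneg g_nonneg)
      then show ?thesis
        unfolding Pair prod.case by (simp only: distrib_left mult_ac)
    qed
  qed
  also have "\<dots> = 2 * (\<integral>t. ?V t \<bullet> ?U t \<partial>?M) + 2 * (\<integral>t. ?U t \<bullet> ?V t \<partial>?M)"
    unfolding VU(1) UV(1) using VU(3) UV(3)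
    by (subst Bochner_Integration.integral_add) (simp_all del: integral_mult_right_zero)
  also have "\<dots> = (\<integral>t. 4 * (?U t \<bullet> ?V t) \<partial>?M)"
    by (simp add: inner_commute)
  \<comment> \<open>The weights come from the square of |V| - 4 |U|; they leave only half of the
    left-hand side on the right.\<close>
  also have "\<dots> \<le> (\<integral>t. (?V t \<bullet> ?V t) / 2 + 8 * (?U t \<bullet> ?U t) \<partial>?M)"
  proof (rule integral_mono)
    fix t
    have "4 * (?U t \<bullet> ?V t) \<le> 4 * (norm (?U t) * norm (?V t))"
      by (simp add: norm_cauchy_schwarz)
    also have "\<dots> \<le> (norm (?V t))\<^sup>2 / 2 + 8 * (norm (?U t))\<^sup>2"
      using zero_le_power2[of "norm (?V t) - 4 * norm (?U t)"]
      by (simp add: power2_eq_square algebra_simps)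
    finally show "4 * (?U t \<bullet> ?V t) \<le> (?V t \<bullet> ?V t) / 2 + 8 * (?U t \<bullet> ?U t)"
      by (simp add: power2_norm_eq_inner)
  qed (intro Bochner_Integration.integrable_add integrable_mult_right integrable_divide UV(2) VV(2) UU(2))+
  also have "\<dots> = (\<integral>t. ?V t \<bullet> ?V t \<partial>?M) / 2 + 8 * (\<integral>t. ?U t \<bullet> ?U t \<partial>?M)"
    using VV(2) UU(2) by (subst Bochner_Integration.integral_add) simp_all
  finally show ?thesis
    using Y by (simp add: power2_norm_eq_inner)
qed

text \<open>The kernel of the quadratic form is positive, so passing from \<open>g\<close> to its
  absolute value can only increase the form.\<close>

lemma dual_laplace_L2_real:
  fixes g :: "real \<Rightarrow> real" and b c :: real
  defines "N \<equiv> restrict_space lborel {b..c}"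
  assumes a: "0 < a" and x: "\<And>y. a \<le> x y" and x_meas: "x \<in> borel_measurable borel"
    and g: "integrable N g" and g2: "integrable N (\<lambda>y. (g y)\<^sup>2)"
  shows "(\<integral>t. (norm (dual_laplace b c x g t))\<^sup>2 \<partial>lebesgue_on {0<..}) \<le> 16 * pi * (\<integral>y. (g y)\<^sup>2 \<partial>N)"
    and "integrable (lebesgue_on {0<..}) (\<lambda>t. (norm (dual_laplace b c x g t))\<^sup>2)"
proof -
  let ?M = "lebesgue_on {0::real<..}"
  have abs: "integrable N (\<lambda>y. \<bar>g y\<bar>)"
    using g by (rule integrable_abs)
  note form = dual_laplace_inner[OF a x x x_meas x_meas, of b c, folded N_def]
  show "integrable ?M (\<lambda>t. (norm (dual_laplace b c x g t))\<^sup>2)"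
    unfolding power2_norm_eq_inner by (rule form(2)[OF g g])
  have "(\<integral>t. (norm (dual_laplace b c x g t))\<^sup>2 \<partial>?M) \<le>
      (\<integral>t. (norm (dual_laplace b c x (\<lambda>y. \<bar>g y\<bar>) t))\<^sup>2 \<partial>?M)"
    unfolding power2_norm_eq_inner form(1)[OF g g] form(1)[OF abs abs]
  proof (rule integral_mono[OF form(3)[OF g g] form(3)[OF abs abs]], clarify)
    fix y y'
    have "0 < x y + x y'"
      using a x[of y] x[of y'] by linarith
    then show "g y * g y' * ((x y + x y') / ((x y + x y')\<^sup>2 + (y - y')\<^sup>2))
        \<le> \<bar>g y\<bar> * \<bar>g y'\<bar> * ((x y + x y') / ((x y + x y')\<^sup>2 + (y - y')\<^sup>2))"
      by (intro mult_right_mono) (simp_all flip: abs_mult)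
  qed
  also have "\<dots> \<le> 16 * pi * (\<integral>y. \<bar>g y\<bar>\<^sup>2 \<partial>N)"
    using dual_laplace_L2_nonneg[OF a x x_meas, of b c "\<lambda>y. \<bar>g y\<bar>"] abs g2 by (simp add: N_def)
  finally show "(\<integral>t. (norm (dual_laplace b c x g t))\<^sup>2 \<partial>?M) \<le> 16 * pi * (\<integral>y. (g y)\<^sup>2 \<partial>N)"
    by simp
qed

text \<open>Real and imaginary parts of \<open>g\<close> are treated separately. Their transforms
  are both complex, so they are recombined by the triangle inequality, which doubles the constant to
  32 pi.\<close>

lemma dual_laplace_L2:
  fixes g :: "real \<Rightarrow> complex" and b c :: real
  defines "N \<equiv> restrict_space lborel {b..c}"
  assumes a: "0 < a" and x: "\<And>y. a \<le> x y" and x_meas: "x \<in> borel_measurable borel"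
    and g: "integrable N g" and g2: "integrable N (\<lambda>y. (norm (g y))\<^sup>2)"
  shows "(\<integral>t. (norm (dual_laplace b c x g t))\<^sup>2 \<partial>lebesgue_on {0<..}) \<le> 32 * pi * (\<integral>y. (norm (g y))\<^sup>2 \<partial>N)"
    and "integrable (lebesgue_on {0<..}) (\<lambda>t. (norm (dual_laplace b c x g t))\<^sup>2)"
proof -
  let ?M = "lebesgue_on {0::real<..}"
  let ?g1 = "\<lambda>y. Re (g y)" and ?g2 = "\<lambda>y. Im (g y)"
  let ?W = "dual_laplace b c x"
  note [measurable] = borel_measurable_integrable[OF g]
  have int: "integrable N ?g1" "integrable N ?g2"
    using g by auto
  have int2: "integrable N (\<lambda>y. (Re (g y))\<^sup>2)" "integrable N (\<lambda>y. (Im (g y))\<^sup>2)"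
    by (rule Bochner_Integration.integrable_bound[OF g2]; simp add: cmod_power2)+
  have "\<And>y. 0 \<le> x y"
    using a x by (meson less_imp_le order_trans)
  then have intk: "integrable N (\<lambda>y. complex_of_real (Re (g y)) * vkernel x t y)"
    "integrable N (\<lambda>y. complex_of_real (Im (g y)) * vkernel x t y)" if "0 < t" for t
    unfolding N_def using that x_meas int by (auto intro!: integrable_vkernel simp: N_def)
  \<comment> \<open>Additivity of the Bochner integral needs both integrands integrable, which is
    available for positive t.\<close>
  then have split: "?W g t = ?W ?g1 t + \<i> * ?W ?g2 t" if "0 < t" for t
  proof -
    have "?W g t = (\<integral>y. of_real (Re (g y)) * vkernel x t y + \<i> * (of_real (Im (g y)) * vkernel x t y) \<partial>N)"
      unfolding dual_laplace_def N_def
      by (subst complex_eq, intro Bochner_Integration.integral_cong refl) (simp add: distrib_right mult.assoc)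
    also have "\<dots> = ?W ?g1 t + \<i> * ?W ?g2 t"
      using intk[OF that] unfolding dual_laplace_def N_def[symmetric]
      by (subst Bochner_Integration.integral_add) auto
    finally show ?thesis .
  qed
  have le: "(norm (?W g t))\<^sup>2 \<le> 2 * (norm (?W ?g1 t))\<^sup>2 + 2 * (norm (?W ?g2 t))\<^sup>2" if "0 < t" for t
  proof -
    have "(norm (?W g t))\<^sup>2 \<le> (norm (?W ?g1 t) + norm (?W ?g2 t))\<^sup>2"
      unfolding split[OF that]
      by (intro power_mono norm_triangle_le) (simp_all add: norm_mult)
    also have "\<dots> \<le> 2 * (norm (?W ?g1 t))\<^sup>2 + 2 * (norm (?W ?g2 t))\<^sup>2"
      using sum_squares_bound[of "norm (?W ?g1 t)" "norm (?W ?g2 t)"] by (simp add: power2_sum)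
    finally show ?thesis .
  qed
  note L2 = dual_laplace_L2_real[OF a x x_meas, of b c, folded N_def]
  have int3: "integrable ?M (\<lambda>t. 2 * (norm (?W ?g1 t))\<^sup>2 + 2 * (norm (?W ?g2 t))\<^sup>2)"
    by (intro Bochner_Integration.integrable_add integrable_mult_right L2(2) int int2)
  have [measurable]: "?W g \<in> borel_measurable ?M"
  proof -
    interpret N: finite_measure N
      unfolding N_def by (rule finite_measure_lborel_Icc)
    note [measurable] = measurable_vkernel[OF x_meas, of b c, folded N_def]
    show ?thesis
      unfolding dual_laplace_def N_def[symmetric] by measurable
  qed
  show int4: "integrable ?M (\<lambda>t. (norm (?W g t))\<^sup>2)"
    using le by (intro Bochner_Integration.integrable_bound[OF int3] AE_I2) auto
  have "(\<integral>t. (norm (?W g t))\<^sup>2 \<partial>?M) \<le> (\<integral>t. 2 * (norm (?W ?g1 t))\<^sup>2 + 2 * (norm (?W ?g2 t))\<^sup>2 \<partial>?M)"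
    using le by (intro integral_mono[OF int4 int3]) simp
  also have "\<dots> = 2 * (\<integral>t. (norm (?W ?g1 t))\<^sup>2 \<partial>?M) + 2 * (\<integral>t. (norm (?W ?g2 t))\<^sup>2 \<partial>?M)"
    using L2(2)[OF int(1) int2(1)] L2(2)[OF int(2) int2(2)]
    by (subst Bochner_Integration.integral_add) (simp_all del: integral_mult_right_zero)
  also have "\<dots> \<le> 32 * pi * ((\<integral>y. (Re (g y))\<^sup>2 \<partial>N) + (\<integral>y. (Im (g y))\<^sup>2 \<partial>N))"
    using L2(1)[OF int(1) int2(1)] L2(1)[OF int(2) int2(2)] by (simp add: algebra_simps)
  also have "\<dots> = 32 * pi * (\<integral>y. (norm (g y))\<^sup>2 \<partial>N)"
    using int2 by (simp add: cmod_power2)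
  finally show "(\<integral>t. (norm (?W g t))\<^sup>2 \<partial>?M) \<le> 32 * pi * (\<integral>y. (norm (g y))\<^sup>2 \<partial>N)" .
qed

section \<open>Riesz--Thorin interpolation\<close>

text \<open>Hadamard's three lines theorem, for entire functions since only finite exponential sums
  occur. A Gaussian factor reduces it to the maximum principle on a rectangle.\<close>

lemma three_lines:
  assumes hol: "F holomorphic_on UNIV"
    and bound: "\<And>z. 0 \<le> Re z \<Longrightarrow> Re z \<le> 1 \<Longrightarrow> norm (F z) \<le> L"
    and left: "\<And>z. Re z = 0 \<Longrightarrow> norm (F z) \<le> M0"
    and right: "\<And>z. Re z = 1 \<Longrightarrow> norm (F z) \<le> M1"
    and M: "0 < M0" "0 < M1" and \<theta>: "0 \<le> \<theta>" "\<theta> \<le> 1"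
  shows "norm (F (of_real \<theta>)) \<le> M0 powr (1 - \<theta>) * M1 powr \<theta>"
proof -
  \<comment> \<open>Multiplication by M0^(z-1) * M1^(-z) normalizes both edge bounds to 1.\<close>
  define G where "G z = F z * exp ((z - 1) * of_real (ln M0) - z * of_real (ln M1))" for z
  have norm_G: "norm (G z) = norm (F z) * (M0 powr (Re z - 1) * M1 powr (- Re z))" for z
    using M by (simp add: G_def norm_mult powr_def exp_add[symmetric])
  define L' where "L' = L * exp (\<bar>ln M0\<bar> + \<bar>ln M1\<bar>)"
  have "0 \<le> L"
    using bound[of 0] order_trans[OF norm_ge_zero] by auto
  then have L': "0 \<le> L'"
    by (simp add: L'_def)
  have G_bound: "norm (G z) \<le> L'" if "0 \<le> Re z" "Re z \<le> 1" for z
  proof -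
    have *: "u * v \<le> \<bar>v\<bar>" if "\<bar>u\<bar> \<le> 1" for u v :: real
      using mult_right_mono[OF that, of "\<bar>v\<bar>"] abs_ge_self[of "u * v"] by (simp add: abs_mult)
    have "(Re z - 1) * ln M0 \<le> \<bar>ln M0\<bar>" "- Re z * ln M1 \<le> \<bar>ln M1\<bar>"
      using that *[of "Re z - 1" "ln M0"] *[of "- Re z" "ln M1"] by simp_all
    then have "M0 powr (Re z - 1) * M1 powr (- Re z) \<le> exp (\<bar>ln M0\<bar> + \<bar>ln M1\<bar>)"
      using M by (simp add: powr_def flip: exp_add)
    then show ?thesis
      unfolding norm_G L'_def using bound[OF that] \<open>0 \<le> L\<close> by (intro mult_mono) auto
  qed
  have G_edge: "norm (G z) \<le> 1" if "Re z = 0 \<or> Re z = 1" for z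
    using that left[of z] right[of z] M by (auto simp: norm_G powr_minus_divide)
  have eps: "norm (G \<theta>) * exp (\<epsilon> * (\<theta>\<^sup>2 - 1)) \<le> 1" if \<epsilon>: "0 < \<epsilon>" for \<epsilon>
  proof -
    \<comment> \<open>On the strip the exponent has real part at most - \<epsilon> * (Im z)^2, so
      the factor has modulus at most 1 and forces decay as |Im z| grows.\<close>
    define H where "H z = G z * exp (of_real \<epsilon> * (z\<^sup>2 - 1))" for z
    have norm_H: "norm (H z) = norm (G z) * exp (\<epsilon> * ((Re z)\<^sup>2 - (Im z)\<^sup>2 - 1))" for z
      by (simp add: H_def norm_mult Re_power2)
    \<comment> \<open>High enough that the Gaussian decay beats the bound \<open>L'\<close> on the
      horizontal sides: there |H| \<le> \<open>L' * exp (- L')\<close> \<le> 1.\<close>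
    define Y where "Y = sqrt (L' / \<epsilon>) + 1"
    have Y: "0 < Y" "L' \<le> \<epsilon> * Y\<^sup>2"
    proof -
      show "0 < Y"
        using L' \<epsilon> by (simp add: Y_def add_nonneg_pos)
      have "(sqrt (L' / \<epsilon>))\<^sup>2 \<le> Y\<^sup>2"
        using L' \<epsilon> by (intro power_mono) (auto simp: Y_def)
      then show "L' \<le> \<epsilon> * Y\<^sup>2"
        using L' \<epsilon> by (simp add: field_simps)
    qed
    have "norm (H (of_real \<theta>)) \<le> 1"
    proof (rule maximum_modulus_frontier[where f = H and \<xi> = "of_real \<theta>" and S = "cbox (Complex 0 (- Y)) (Complex 1 Y)"])
      have H: "H holomorphic_on UNIV"
        unfolding H_def G_def by (intro holomorphic_intros hol)
      then show "H holomorphic_on interior (cbox (Complex 0 (- Y)) (Complex 1 Y))"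
        by (rule holomorphic_on_subset) simp
      show "continuous_on (closure (cbox (Complex 0 (- Y)) (Complex 1 Y))) H"
        using holomorphic_on_imp_continuous_on[OF H] by (rule continuous_on_subset) simp
      show "complex_of_real \<theta> \<in> cbox (Complex 0 (- Y)) (Complex 1 Y)"
        using \<theta> Y by (simp add: in_cbox_complex_iff)
      fix z assume "z \<in> frontier (cbox (Complex 0 (- Y)) (Complex 1 Y))"
      then have z: "0 \<le> Re z" "Re z \<le> 1" "(Re z = 0 \<or> Re z = 1) \<or> \<bar>Im z\<bar> = Y"
        by (auto simp: frontier_cbox in_cbox_complex_iff in_box_complex_iff)
      have Re1: "(Re z)\<^sup>2 \<le> 1"
        using z by (simp add: power_le_one)
      show "norm (H z) \<le> 1"
      proof (cases "Re z = 0 \<or> Re z = 1")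
        case True
        have "(Re z)\<^sup>2 - (Im z)\<^sup>2 - 1 \<le> 0"
          using Re1 zero_le_power2[of "Im z"] by linarith
        then have "norm (G z) * exp (\<epsilon> * ((Re z)\<^sup>2 - (Im z)\<^sup>2 - 1)) \<le> 1 * 1"
          using \<epsilon> by (intro mult_mono G_edge True) (auto intro: mult_nonneg_nonpos)
        then show ?thesis by (simp add: norm_H)
      next
        case False
        then have "(Im z)\<^sup>2 = Y\<^sup>2"
          using z by (metis power2_abs)
        then have "\<epsilon> * ((Re z)\<^sup>2 - (Im z)\<^sup>2 - 1) \<le> \<epsilon> * (- Y\<^sup>2)"
          using Re1 \<epsilon> by (intro mult_left_mono) auto
        also have "\<dots> \<le> - L'"
          using Y by simp
        finally have "norm (G z) * exp (\<epsilon> * ((Re z)\<^sup>2 - (Im z)\<^sup>2 - 1)) \<le> L' * exp (- L')"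
          using G_bound[OF z(1,2)] L' by (intro mult_mono) auto
        also have "L' * exp (- L') \<le> exp L' * exp (- L')"
          using exp_ge_add_one_self[of L'] by (intro mult_right_mono; linarith?) simp
        also have "\<dots> = 1"
          by (simp flip: exp_add)
        finally show ?thesis by (simp add: norm_H)
      qed
    qed simp
    then show ?thesis
      by (simp add: norm_H)
  qed
  \<comment> \<open>Letting \<epsilon> tend to 0 removes the auxiliary factor at the fixed point
    \<theta>.\<close>
  have "((\<lambda>\<epsilon>. norm (G \<theta>) * exp (\<epsilon> * (\<theta>\<^sup>2 - 1))) \<longlongrightarrow> norm (G \<theta>) * exp (0 * (\<theta>\<^sup>2 - 1))) (at_right 0)"
    by (intro tendsto_intros)
  then have "norm (G \<theta>) * exp (0 * (\<theta>\<^sup>2 - 1)) \<le> 1"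
    by (rule tendsto_upperbound) (auto intro!: eps eventually_at_rightI[of 0 1])
  then have "norm (F \<theta>) * (M0 powr (\<theta> - 1) * M1 powr (- \<theta>)) \<le> 1"
    by (simp add: norm_G)
  then have "norm (F \<theta>) * (M0 powr (\<theta> - 1) * M1 powr (- \<theta>)) * (M0 powr (1 - \<theta>) * M1 powr \<theta>)
      \<le> 1 * (M0 powr (1 - \<theta>) * M1 powr \<theta>)"
    by (intro mult_right_mono) auto
  moreover have "M0 powr (\<theta> - 1) * M1 powr (- \<theta>) * (M0 powr (1 - \<theta>) * M1 powr \<theta>) = 1"
    using M by (simp add: powr_def exp_add[symmetric] algebra_simps)
  ultimately show ?thesis
    by (simp add: mult.assoc)
qed

section \<open>Complex powers and simple functions\<close>

text \<open>The phase of \<open>a\<close> times |a|^s: entire in \<open>s\<close>, equal to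
  \<open>a\<close> at s = 1. Since \<open>sgn 0 = 0\<close>, zero stays zero for every exponent, so
  supports do not grow.\<close>

definition cpow :: "complex \<Rightarrow> complex \<Rightarrow> complex" where
  "cpow s a = sgn a * exp (s * of_real (ln (norm a)))"

lemma cpow_0 [simp]: "cpow s 0 = 0"
  by (simp add: cpow_def)

lemma cpow_1 [simp]: "cpow 1 a = a"
  by (cases "a = 0") (simp_all add: cpow_def exp_of_real sgn_div_norm scaleR_conv_of_real)

lemma norm_cpow: "norm (cpow s a) = norm a powr Re s"
  by (simp add: cpow_def norm_mult norm_sgn powr_def)

lemma holomorphic_cpow:
  assumes "s holomorphic_on S"
  shows "(\<lambda>z. cpow (s z) a) holomorphic_on S"
  unfolding cpow_def by (intro holomorphic_intros assms)

text \<open>On the finite range of \<open>f\<close>, |h| is at most a constant times the p-th power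
  of the modulus. \<open>C\<close> sums all the ratios; the one at 0 is 0 by division by
  zero.\<close>

lemma integrable_simple_compose:
  fixes f :: "'a \<Rightarrow> complex" and h :: "complex \<Rightarrow> 'b::{banach,second_countable_topology}"
  assumes f: "simple_function M f" and int: "integrable M (\<lambda>t. norm (f t) powr p)" and h: "h 0 = 0"
  shows "integrable M (\<lambda>t. h (f t))"
proof -
  define C where "C = (\<Sum>a\<in>f ` space M. norm (h a) / norm a powr p)"
  have "integrable M (\<lambda>t. C * norm (f t) powr p)"
    using int by simp
  then show ?thesis
  proof (rule Bochner_Integration.integrable_bound)
    show "(\<lambda>t. h (f t)) \<in> borel_measurable M"
      using simple_function_compose[OF f, of h] by (intro borel_measurable_simple_function) (simp add: o_def)
    show "AE t in M. norm (h (f t)) \<le> norm (C * norm (f t) powr p)"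
    proof (rule AE_I2)
      fix t assume t: "t \<in> space M"
      show "norm (h (f t)) \<le> norm (C * norm (f t) powr p)"
      proof (cases "f t = 0")
        case False
        have "norm (h (f t)) / norm (f t) powr p \<le> C"
          unfolding C_def using simple_functionD(1)[OF f] t by (intro member_le_sum) auto
        then have "norm (h (f t)) \<le> C * norm (f t) powr p"
          using False by (simp add: divide_simps)
        then show ?thesis by simp
      qed (simp add: h)
    qed
  qed
qed

section \<open>Interpolation for operators with a kernel bounded by 1\<close>

text \<open>The bound \<open>k_le\<close> is the endpoint from L^1 to L^infinity, with norm at most
  1. Finiteness of \<open>N\<close> makes bounded functions integrable.\<close>

locale bounded_kernel = pair_sigma_finite M N + N: finite_measure N
  for M :: "'a measure" and N :: "'b measure" +
  fixes k :: "'a \<Rightarrow> 'b \<Rightarrow> complex"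
  assumes k_meas [measurable]: "(\<lambda>(t, y). k t y) \<in> borel_measurable (M \<Otimes>\<^sub>M N)"
    and k_le: "\<And>t y. t \<in> space M \<Longrightarrow> y \<in> space N \<Longrightarrow> norm (k t y) \<le> 1"
begin

text \<open>The pairing of the operator's value at \<open>f\<close> with \<open>g\<close>. It is
  bilinear rather than sesquilinear, so inserting families holomorphic in z leaves it
  holomorphic.\<close>

definition form :: "('a \<Rightarrow> complex) \<Rightarrow> ('b \<Rightarrow> complex) \<Rightarrow> complex" where
  "form f g = (\<integral>(t, y). f t * g y * k t y \<partial>(M \<Otimes>\<^sub>M N))"

lemma integrable_form:
  assumes "integrable M f" "integrable N g"
  shows "integrable (M \<Otimes>\<^sub>M N) (\<lambda>(t, y). f t * g y * k t y)"
  using assms k_le by (intro integrable_mult_kernel[where B = 1]) auto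

lemma form_fst:
  assumes "integrable M f" "integrable N g"
  shows "form f g = (\<integral>t. f t * (\<integral>y. g y * k t y \<partial>N) \<partial>M)"
  unfolding form_def by (subst integral_fst[OF integrable_form[OF assms], symmetric]) (simp add: mult.assoc)

lemma form_snd:
  assumes "integrable M f" "integrable N g"
  shows "form f g = (\<integral>y. g y * (\<integral>t. f t * k t y \<partial>M) \<partial>N)"
proof -
  have "(\<integral>t. f t * g y * k t y \<partial>M) = g y * (\<integral>t. f t * k t y \<partial>M)" for y
    by (subst integral_mult_right_zero[symmetric]) (simp only: mult_ac)
  then show ?thesis
    unfolding form_def by (subst integral_snd[OF integrable_form[OF assms], symmetric]) simp
qed

lemma norm_form_le:
  assumes f: "integrable M f" and g: "integrable N g"
  shows "norm (form f g) \<le> (\<integral>t. norm (f t) \<partial>M) * (\<integral>y. norm (g y) \<partial>N)"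
proof -
  have int: "integrable (M \<Otimes>\<^sub>M N) (\<lambda>(t, y). norm (f t) * norm (g y) * (1::real))"
    using f g by (intro integrable_mult_kernel[where B = 1]) auto
  have "norm (form f g) \<le> (\<integral>z. norm (case z of (t, y) \<Rightarrow> f t * g y * k t y) \<partial>(M \<Otimes>\<^sub>M N))"
    unfolding form_def by (rule integral_norm_bound)
  also have "\<dots> \<le> (\<integral>(t, y). norm (f t) * norm (g y) * 1 \<partial>(M \<Otimes>\<^sub>M N))"
  proof (rule integral_mono[OF integrable_norm[OF integrable_form[OF f g]] int])
    fix z assume "z \<in> space (M \<Otimes>\<^sub>M N)"
    then show "norm (case z of (t, y) \<Rightarrow> f t * g y * k t y) \<le> (case z of (t, y) \<Rightarrow> norm (f t) * norm (g y) * 1)"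
      by (auto simp: space_pair_measure norm_mult intro!: mult_left_le k_le)
  qed
  also have "\<dots> = (\<integral>t. norm (f t) \<partial>M) * (\<integral>y. norm (g y) \<partial>N)"
    by (subst integral_fst[OF int, symmetric]) simp
  finally show ?thesis .
qed

text \<open>With complex powers for \<open>h1\<close> and \<open>h2\<close>, the form becomes a
  finite sum of holomorphic functions, so no differentiation under the integral is needed.\<close>

lemma form_simple_expand:
  fixes f :: "'a \<Rightarrow> complex" and g :: "'b \<Rightarrow> complex"
  assumes f: "simple_function M f" "integrable M f" and g: "simple_function N g" "integrable N g"
    and h: "h1 0 = 0" "h2 0 = 0"
  shows "form (\<lambda>t. h1 (f t)) (\<lambda>y. h2 (g y)) =
    (\<Sum>a\<in>f ` space M - {0}. \<Sum>b\<in>g ` space N - {0}.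
      h1 a * h2 b * form (\<lambda>t. of_bool (f t = a)) (\<lambda>y. of_bool (g y = b)))"
proof -
  \<comment> \<open>The value 0 is left out: its level set may have infinite measure, and then its
    indicator is not integrable.\<close>
  let ?V = "f ` space M - {0}" and ?W = "g ` space N - {0}"
  have fin: "finite ?V" "finite ?W"
    using simple_functionD(1)[OF f(1)] simple_functionD(1)[OF g(1)] by auto
  have int: "integrable (M \<Otimes>\<^sub>M N) (\<lambda>(t, y). of_bool (f t = a) * of_bool (g y = b) * k t y)"
    if "a \<in> ?V" "b \<in> ?W" for a b
  proof (rule integrable_form)
    show "integrable M (\<lambda>t. of_bool (f t = a) :: complex)"
      using that integrable_simple_compose[OF f(1), of 1 "\<lambda>c. of_bool (c = a)"] f(2) by auto
    show "integrable N (\<lambda>y. of_bool (g y = b) :: complex)"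
      using that integrable_simple_compose[OF g(1), of 1 "\<lambda>c. of_bool (c = b)"] g(2) by auto
  qed
  have *: "h c = (\<Sum>a\<in>S - {0}. h a * of_bool (c = a))" if "c \<in> S" "h 0 = 0" "finite (S - {0})"
    for h :: "complex \<Rightarrow> complex" and c S
  proof (cases "c = 0")
    case True
    then show ?thesis using that by (auto intro!: sum.neutral)
  next
    case False
    then show ?thesis using that by (simp add: of_bool_def if_distrib cong: if_cong)
  qed
  have "form (\<lambda>t. h1 (f t)) (\<lambda>y. h2 (g y)) = (\<integral>z. (\<Sum>a\<in>?V. \<Sum>b\<in>?W. h1 a * h2 b *
      (case z of (t, y) \<Rightarrow> of_bool (f t = a) * of_bool (g y = b) * k t y)) \<partial>(M \<Otimes>\<^sub>M N))"
    unfolding form_def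
  proof (rule Bochner_Integration.integral_cong, simp, clarsimp simp: space_pair_measure)
    fix t y assume t: "t \<in> space M" and y: "y \<in> space N"
    have e1: "h1 (f t) = (\<Sum>a\<in>?V. h1 a * of_bool (f t = a))"
      by (rule *[where h = h1 and S = "f ` space M"]; use t h fin in simp)
    have e2: "h2 (g y) = (\<Sum>b\<in>?W. h2 b * of_bool (g y = b))"
      by (rule *[where h = h2 and S = "g ` space N"]; use y h fin in simp)
    have "h1 (f t) * h2 (g y) * k t y =
        (\<Sum>a\<in>?V. \<Sum>b\<in>?W. (h1 a * of_bool (f t = a)) * (h2 b * of_bool (g y = b))) * k t y"
      by (subst e1, subst e2) (simp only: sum_product)
    also have "\<dots> = (\<Sum>a\<in>?V. \<Sum>b\<in>?W. h1 a * h2 b * (of_bool (f t = a) * of_bool (g y = b) * k t y))"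
      unfolding sum_distrib_right by (intro sum.cong refl) (simp only: mult_ac)
    finally show "h1 (f t) * h2 (g y) * k t y =
        (\<Sum>a\<in>?V. \<Sum>b\<in>?W. h1 a * h2 b * (of_bool (f t = a) * of_bool (g y = b) * k t y))" .
  qed
  also have "\<dots> = (\<Sum>a\<in>?V. \<Sum>b\<in>?W. h1 a * h2 b * form (\<lambda>t. of_bool (f t = a)) (\<lambda>y. of_bool (g y = b)))"
    unfolding form_def
  proof (subst Bochner_Integration.integral_sum)
    show "integrable (M \<Otimes>\<^sub>M N) (\<lambda>z. \<Sum>b\<in>?W. h1 a * h2 b *
        (case z of (t, y) \<Rightarrow> of_bool (f t = a) * of_bool (g y = b) * k t y))" if "a \<in> ?V" for a
      using that by (intro Bochner_Integration.integrable_sum integrable_mult_right int)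
    show "(\<Sum>a\<in>?V. \<integral>z. (\<Sum>b\<in>?W. h1 a * h2 b *
        (case z of (t, y) \<Rightarrow> of_bool (f t = a) * of_bool (g y = b) * k t y)) \<partial>(M \<Otimes>\<^sub>M N)) =
      (\<Sum>a\<in>?V. \<Sum>b\<in>?W. h1 a * h2 b *
        (\<integral>(t, y). of_bool (f t = a) * of_bool (g y = b) * k t y \<partial>(M \<Otimes>\<^sub>M N)))"
    proof (rule sum.cong[OF refl])
      fix a assume "a \<in> ?V"
      then show "(\<integral>z. (\<Sum>b\<in>?W. h1 a * h2 b *
          (case z of (t, y) \<Rightarrow> of_bool (f t = a) * of_bool (g y = b) * k t y)) \<partial>(M \<Otimes>\<^sub>M N)) =
        (\<Sum>b\<in>?W. h1 a * h2 b *
          (\<integral>(t, y). of_bool (f t = a) * of_bool (g y = b) * k t y \<partial>(M \<Otimes>\<^sub>M N)))"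
        using int by (subst Bochner_Integration.integral_sum) auto
    qed
  qed
  finally show ?thesis .
qed

text \<open>The second argument is measured in L^p as well, because L^p is the dual exponent of the
  target L^q. Positive upper bounds \<open>A\<close> and \<open>B\<close> replace the integrals
  themselves, since \<open>three_lines\<close> needs positive edge bounds.\<close>

lemma riesz_thorin_simple:
  assumes pq: "1 < p" "p \<le> 2" "1 / p + 1 / q = 1" and C: "0 < C"
    and L2: "\<And>f g. simple_function M f \<Longrightarrow> integrable M f \<Longrightarrow> simple_function N g \<Longrightarrow> integrable N g \<Longrightarrow>
      (norm (form f g))\<^sup>2 \<le> C * (\<integral>t. (norm (f t))\<^sup>2 \<partial>M) * (\<integral>y. (norm (g y))\<^sup>2 \<partial>N)"
    and f: "simple_function M f" "integrable M f" and g: "simple_function N g" "integrable N g"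
    and A: "(\<integral>t. norm (f t) powr p \<partial>M) \<le> A" "0 < A"
    and B: "(\<integral>y. norm (g y) powr p \<partial>N) \<le> B" "0 < B"
  shows "norm (form f g) \<le> C powr (1 / q) * (A * B) powr (1 / p)"
proof -
  define \<theta> where "\<theta> = 2 / q"
  \<comment> \<open>The moduli are |f|^p on the left edge, where the L^1 bound applies, and
    |f|^(p/2) on the right edge, where the L^2 bound applies. At \<open>\<theta>\<close> the
    exponent is 1, which returns \<open>f\<close> and \<open>g\<close>.\<close>
  define s where "s z = of_real p * (1 - z / 2)" for z :: complex
  define F where "F z = form (\<lambda>t. cpow (s z) (f t)) (\<lambda>y. cpow (s z) (g y))" for z
  define c where "c a b = form (\<lambda>t. of_bool (f t = a)) (\<lambda>y. of_bool (g y = b))" for a b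
  let ?V = "f ` space M - {0}" and ?W = "g ` space N - {0}"
  have inv_q: "1 / q = 1 - 1 / p"
    using pq by simp
  have \<theta>: "0 \<le> \<theta>" "\<theta> \<le> 1" "\<theta> = 2 - 2 / p"
  proof -
    show "\<theta> = 2 - 2 / p"
      using inv_q by (simp add: \<theta>_def)
    moreover have "1 / p \<le> 1" "1 / 2 \<le> 1 / p"
      using pq by (auto simp: frac_le)
    ultimately show "0 \<le> \<theta>" "\<theta> \<le> 1"
      by simp_all
  qed
  have expand: "F z = (\<Sum>a\<in>?V. \<Sum>b\<in>?W. cpow (s z) a * cpow (s z) b * c a b)" for z
    unfolding F_def c_def by (rule form_simple_expand[OF f g]) simp_all
  have simple: "simple_function M (\<lambda>t. cpow z (f t))" "simple_function N (\<lambda>y. cpow z (g y))" for z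
    using simple_function_compose[OF f(1), of "cpow z"] simple_function_compose[OF g(1), of "cpow z"]
    by (simp_all add: o_def)
  have integrable: "integrable M (\<lambda>t. cpow z (f t))" "integrable N (\<lambda>y. cpow z (g y))" for z
    using integrable_simple_compose[OF f(1), of 1 "cpow z"] integrable_simple_compose[OF g(1), of 1 "cpow z"] f(2) g(2)
    by simp_all
  have nonneg: "0 \<le> (\<integral>t. norm (f t) powr p \<partial>M)" "0 \<le> (\<integral>y. norm (g y) powr p \<partial>N)"
    by simp_all
  have Re_s: "Re (s z) = p * (1 - Re z / 2)" for z
    by (simp add: s_def)
  have "norm (F (of_real \<theta>)) \<le> (A * B) powr (1 - \<theta>) * sqrt (C * A * B) powr \<theta>"
  proof (rule three_lines[OF _ _ _ _ _ _ \<theta>(1,2)])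
    show "F holomorphic_on UNIV"
      unfolding expand[abs_def] s_def
      by (intro holomorphic_on_sum holomorphic_on_mult holomorphic_cpow holomorphic_intros) auto
    show "norm (F z) \<le> (\<Sum>a\<in>?V. \<Sum>b\<in>?W. (1 + norm a) powr p * (1 + norm b) powr p * norm (c a b))"
      if "0 \<le> Re z" "Re z \<le> 1" for z
    proof -
      have "0 \<le> p * (1 - Re z / 2)"
        using that pq by simp
      moreover have "p * (1 - Re z / 2) \<le> p * 1"
        using that pq by (intro mult_left_mono) auto
      ultimately have "norm (cpow (s z) a) \<le> (1 + norm a) powr p" for a
        unfolding norm_cpow Re_s
        by (intro order_trans[OF powr_mono2 powr_mono]) auto
      then show ?thesis
        unfolding expand by (intro sum_norm_le) (auto simp: norm_mult intro!: mult_mono)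
    qed
    show "norm (F z) \<le> A * B" if "Re z = 0" for z
    proof -
      have "norm (F z) \<le> (\<integral>t. norm (cpow (s z) (f t)) \<partial>M) * (\<integral>y. norm (cpow (s z) (g y)) \<partial>N)"
        unfolding F_def by (intro norm_form_le integrable)
      also have "\<dots> \<le> A * B"
        unfolding norm_cpow Re_s that using A B nonneg by (intro mult_mono) auto
      finally show ?thesis .
    qed
    show "norm (F z) \<le> sqrt (C * A * B)" if "Re z = 1" for z
    proof (rule real_le_rsqrt)
      have sq: "(x powr (p / 2))\<^sup>2 = x powr p" if "0 \<le> x" for x :: real
        by (simp add: power2_eq_square flip: powr_add)
      have "(norm (F z))\<^sup>2 \<le> C * (\<integral>t. (norm (cpow (s z) (f t)))\<^sup>2 \<partial>M) * (\<integral>y. (norm (cpow (s z) (g y)))\<^sup>2 \<partial>N)"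
        unfolding F_def by (intro L2 simple integrable)
      also have "\<dots> \<le> C * A * B"
        unfolding norm_cpow Re_s that using A B C nonneg by (intro mult_mono) (auto simp: sq)
      finally show "(norm (F z))\<^sup>2 \<le> C * A * B" .
    qed
  qed (use A B C in auto)
  moreover have "F (of_real \<theta>) = form f g"
  proof -
    have "s (of_real \<theta>) = of_real (p * (1 - \<theta> / 2))"
      by (simp add: s_def)
    also have "p * (1 - \<theta> / 2) = 1"
      using pq \<theta>(3) by (simp add: field_simps)
    finally have "s (of_real \<theta>) = 1"
      by simp
    then show ?thesis
      by (simp add: F_def)
  qed
  \<comment> \<open>The square root halves \<open>\<theta>\<close> to 1/q, and (1 - 2/q) + 1/q =
    1/p.\<close>
  moreover have "(A * B) powr (1 - \<theta>) * sqrt (C * A * B) powr \<theta> = C powr (1 / q) * (A * B) powr (1 / p)"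
  proof -
    have "sqrt (C * A * B) powr \<theta> = (C * (A * B)) powr (1 / q)"
      using A B C by (simp add: powr_half_sqrt[symmetric] powr_powr \<theta>_def mult.assoc)
    also have "\<dots> = C powr (1 / q) * (A * B) powr (1 / q)"
      by (rule powr_mult)
    finally have "(A * B) powr (1 - \<theta>) * sqrt (C * A * B) powr \<theta> =
        C powr (1 / q) * (A * B) powr ((1 - \<theta>) + 1 / q)"
      unfolding powr_add by (simp only: mult_ac)
    also have "(1 - \<theta>) + 1 / q = 1 / p"
      using inv_q \<theta>(3) by (simp add: field_simps)
    finally show ?thesis .
  qed
  ultimately show ?thesis
    by simp
qed

lemma norm_integral_kernel_le:
  assumes f: "integrable M f" and y: "y \<in> space N"
  shows "norm (\<integral>t. f t * k t y \<partial>M) \<le> (\<integral>t. norm (f t) \<partial>M)"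
proof -
  have le: "norm (f t * k t y) \<le> norm (f t)" if "t \<in> space M" for t
    using k_le[OF that y] by (simp add: norm_mult mult_left_le)
  have "(\<lambda>t. f t * k t y) \<in> borel_measurable M"
    using borel_measurable_integrable[OF f] y by measurable
  then have "integrable M (\<lambda>t. f t * k t y)"
    using le by (intro Bochner_Integration.integrable_bound[OF f] AE_I2)
  then have "(\<integral>t. norm (f t * k t y) \<partial>M) \<le> (\<integral>t. norm (f t) \<partial>M)"
    using f le by (intro integral_mono integrable_norm)
  then show ?thesis
    by (rule order_trans[OF integral_norm_bound])
qed

text \<open>The extremal test function of the duality argument is bounded but not simple, so
  \<open>g\<close> is approximated by simple functions. As \<open>f\<close> is integrable, its
  transform is bounded and constants serve as majorants.\<close>

lemma riesz_thorin_bounded: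
  assumes pq: "1 < p" "p \<le> 2" "1 / p + 1 / q = 1" and C: "0 < C"
    and L2: "\<And>f g. simple_function M f \<Longrightarrow> integrable M f \<Longrightarrow> simple_function N g \<Longrightarrow> integrable N g \<Longrightarrow>
      (norm (form f g))\<^sup>2 \<le> C * (\<integral>t. (norm (f t))\<^sup>2 \<partial>M) * (\<integral>y. (norm (g y))\<^sup>2 \<partial>N)"
    and f: "simple_function M f" "integrable M f"
    and A: "(\<integral>t. norm (f t) powr p \<partial>M) \<le> A" "0 < A"
    and g: "g \<in> borel_measurable N" "\<And>y. y \<in> space N \<Longrightarrow> norm (g y) \<le> G"
  shows "norm (form f g) \<le> C powr (1 / q) * (A * (\<integral>y. norm (g y) powr p \<partial>N)) powr (1 / p)"
proof -
  obtain u where u: "\<And>i. simple_function N (u i)" "\<And>y. y \<in> space N \<Longrightarrow> (\<lambda>i. u i y) \<longlonglongrightarrow> g y"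
    "\<And>i y. y \<in> space N \<Longrightarrow> norm (u i y) \<le> 2 * norm (g y)"
    using borel_measurable_implies_sequence_metric[OF g(1), of 0] by simp metis
  have le_G: "norm (u i y) \<le> 2 * G" if "y \<in> space N" for i y
    using u(3)[OF that, of i] g(2)[OF that] by linarith
  have u_meas: "u i \<in> borel_measurable N" for i
    using u(1) by (rule borel_measurable_simple_function)
  have u_int: "integrable N (u i)" for i
    using le_G by (intro N.integrable_const_bound[OF _ u_meas] AE_I2)
  have g_int: "integrable N g"
    using g(2) by (intro N.integrable_const_bound[OF _ g(1)] AE_I2)
  define h where "h y = (\<integral>t. f t * k t y \<partial>M)" for y
  have h_meas [measurable]: "h \<in> borel_measurable N"
    unfolding h_def using borel_measurable_integrable[OF f(2)] by measurable
  have h_le: "norm (h y) \<le> (\<integral>t. norm (f t) \<partial>M)" if "y \<in> space N" for y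
    unfolding h_def by (rule norm_integral_kernel_le[OF f(2) that])
  have lim1: "(\<lambda>i. form f (u i)) \<longlonglongrightarrow> form f g"
    unfolding form_snd[OF f(2) u_int] form_snd[OF f(2) g_int] h_def[symmetric]
  proof (rule integral_dominated_convergence[where w = "\<lambda>_. 2 * G * (\<integral>t. norm (f t) \<partial>M)"])
    show "AE y in N. (\<lambda>i. u i y * h y) \<longlonglongrightarrow> g y * h y"
      by (intro AE_I2 tendsto_intros u)
    show "AE y in N. norm (u i y * h y) \<le> 2 * G * (\<integral>t. norm (f t) \<partial>M)" for i
      unfolding norm_mult using order_trans[OF norm_ge_zero le_G]
      by (intro AE_I2 mult_mono le_G h_le) auto
  qed (use g(1) u_meas in auto)
  have lim2: "(\<lambda>i. \<integral>y. norm (u i y) powr p \<partial>N) \<longlonglongrightarrow> (\<integral>y. norm (g y) powr p \<partial>N)"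
  proof (rule integral_dominated_convergence[where w = "\<lambda>_. (2 * G) powr p"])
    show "AE y in N. (\<lambda>i. norm (u i y) powr p) \<longlonglongrightarrow> norm (g y) powr p"
      using pq by (intro AE_I2 tendsto_powr' tendsto_intros u) auto
    show "AE y in N. norm (norm (u i y) powr p) \<le> (2 * G) powr p" for i
      using pq le_G by (intro AE_I2) (auto intro!: powr_mono2)
  qed (use g(1) u_meas in auto)
  \<comment> \<open>The added null sequence keeps the bound \<open>B\<close> of the simple case
    strictly positive.\<close>
  have "(\<lambda>i. C powr (1 / q) * (A * ((\<integral>y. norm (u i y) powr p \<partial>N) + inverse (real (Suc i)))) powr (1 / p))
      \<longlonglongrightarrow> C powr (1 / q) * (A * ((\<integral>y. norm (g y) powr p \<partial>N) + 0)) powr (1 / p)"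
    using pq A by (intro tendsto_intros tendsto_powr' lim2 LIMSEQ_inverse_real_of_nat)
      (auto intro!: always_eventually add_nonneg_nonneg)
  then have lim3: "(\<lambda>i. C powr (1 / q) * (A * ((\<integral>y. norm (u i y) powr p \<partial>N) + inverse (real (Suc i)))) powr (1 / p))
      \<longlonglongrightarrow> C powr (1 / q) * (A * (\<integral>y. norm (g y) powr p \<partial>N)) powr (1 / p)"
    by simp
  show ?thesis
  proof (rule LIMSEQ_le[OF tendsto_norm[OF lim1] lim3])
    have "0 \<le> (\<integral>y. norm (u i y) powr p \<partial>N)" for i
      by simp
    then show "\<exists>m. \<forall>i\<ge>m. norm (form f (u i)) \<le>
        C powr (1 / q) * (A * ((\<integral>y. norm (u i y) powr p \<partial>N) + inverse (real (Suc i)))) powr (1 / p)"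
      by (intro exI allI impI riesz_thorin_simple[OF pq C L2 f u(1) u_int A]) (auto intro: add_nonneg_pos)
  qed
qed

text \<open>Duality: testing against the extremal \<open>g\<close> gives I \<le> C^(1/q) * (A *
  I)^(1/p) for the q-th power integral I, and I^(1/p) is divided out.\<close>

lemma riesz_thorin_simple_norm:
  assumes pq: "1 < p" "p \<le> 2" "1 / p + 1 / q = 1" and C: "0 < C"
    and L2: "\<And>f g. simple_function M f \<Longrightarrow> integrable M f \<Longrightarrow> simple_function N g \<Longrightarrow> integrable N g \<Longrightarrow>
      (norm (form f g))\<^sup>2 \<le> C * (\<integral>t. (norm (f t))\<^sup>2 \<partial>M) * (\<integral>y. (norm (g y))\<^sup>2 \<partial>N)"
    and f: "simple_function M f" "integrable M f"
    and A: "(\<integral>t. norm (f t) powr p \<partial>M) \<le> A" "0 < A"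
  shows "(\<integral>\<^sup>+y. ennreal (norm (\<integral>t. f t * k t y \<partial>M) powr q) \<partial>N) \<le> ennreal (C * A powr (q / p))"
proof -
  define h where "h y = (\<integral>t. f t * k t y \<partial>M)" for y
  \<comment> \<open>Modulus |h|^(q-1) and conjugate phase, so that \<open>g y * h y\<close> is |h|^q
    and, as (q-1) p = q, also |g|^p = |h|^q.\<close>
  define g where "g y = cnj (cpow (of_real (q - 1)) (h y))" for y
  define D where "D = (\<integral>t. norm (f t) \<partial>M)"
  define I where "I = (\<integral>y. norm (h y) powr q \<partial>N)"
  have q: "0 < q" "1 < q" "(q - 1) * p = q" "1 - 1 / p = 1 / q"
  proof -
    have "1 / q = 1 - 1 / p" "0 < 1 - 1 / p" "1 - 1 / p < 1"
      using pq by auto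
    then have "0 < 1 / q" "1 / q < 1"
      by simp_all
    then show "0 < q"
      by (simp only: zero_less_divide_1_iff)
    with \<open>1 / q < 1\<close> show "1 < q"
      by simp
    show "1 - 1 / p = 1 / q"
      using \<open>1 / q = 1 - 1 / p\<close> by simp
    show "(q - 1) * p = q"
      using pq \<open>0 < q\<close> by (simp add: field_simps)
  qed
  have h_meas [measurable]: "h \<in> borel_measurable N"
    unfolding h_def using borel_measurable_integrable[OF f(2)] by measurable
  have h_le: "norm (h y) \<le> D" if "y \<in> space N" for y
    unfolding h_def D_def by (rule norm_integral_kernel_le[OF f(2) that])
  have [measurable]: "cnj \<in> borel_measurable borel"
    by (intro borel_measurable_continuous_onI continuous_intros)
  have [measurable]: "g \<in> borel_measurable N"
    unfolding g_def cpow_def sgn_div_norm by measurable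
  have norm_g: "norm (g y) = norm (h y) powr (q - 1)" for y
    by (simp add: g_def norm_cpow)
  have g_le: "norm (g y) \<le> D powr (q - 1)" if "y \<in> space N" for y
    unfolding norm_g using q h_le[OF that] by (intro powr_mono2) auto
  have g_int: "integrable N g"
    by (intro N.integrable_const_bound[of _ "D powr (q - 1)"] AE_I2 g_le) measurable
  have int: "integrable N (\<lambda>y. norm (h y) powr q)"
    using q h_le by (intro N.integrable_const_bound[of _ "D powr q"] AE_I2) (auto intro!: powr_mono2)
  have gh: "g y * h y = of_real (norm (h y) powr q)" for y
  proof (cases "h y = 0")
    case False
    have "cnj (sgn (h y)) * h y = of_real (norm (h y))"
      using False by (simp add: sgn_div_norm scaleR_conv_of_real complex_norm_square[symmetric] power2_eq_square
          divide_simps mult.commute[of "cnj _"])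
    then have "g y * h y = of_real (exp ((q - 1) * ln (norm (h y))) * norm (h y))"
      using False by (simp add: g_def cpow_def exp_of_real[symmetric] exp_cnj mult_ac)
    also have "exp ((q - 1) * ln (norm (h y))) * norm (h y) = norm (h y) powr q"
      using False by (simp add: powr_def left_diff_distrib exp_diff)
    finally show ?thesis .
  qed (use q in simp)
  have "form f g = of_real I"
    unfolding form_snd[OF f(2) g_int] h_def[symmetric] gh I_def by simp
  moreover have I_nonneg: "0 \<le> I"
    by (simp add: I_def)
  moreover have "norm (form f g) \<le> C powr (1 / q) * (A * (\<integral>y. norm (g y) powr p \<partial>N)) powr (1 / p)"
    by (rule riesz_thorin_bounded[OF pq C L2 f A _ g_le]) measurable
  moreover have "(\<integral>y. norm (g y) powr p \<partial>N) = I"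
    unfolding norm_g I_def powr_powr q ..
  ultimately have le: "I \<le> C powr (1 / q) * (A * I) powr (1 / p)"
    by simp
  have "I \<le> C * A powr (q / p)"
  proof (cases "I = 0")
    case True
    then show ?thesis using C by simp
  next
    case False
    with I_nonneg have I: "0 < I" by simp
    have "I powr (1 / q) * I powr (1 / p) = I"
      using I by (simp add: pq(3) add.commute flip: powr_add)
    also have "\<dots> \<le> (C powr (1 / q) * A powr (1 / p)) * I powr (1 / p)"
      using le A I by (simp add: powr_mult)
    finally have "I powr (1 / q) \<le> C powr (1 / q) * A powr (1 / p)"
      using I by (subst (asm) mult_le_cancel_right) auto
    then have "(I powr (1 / q)) powr q \<le> (C powr (1 / q) * A powr (1 / p)) powr q"
      using q by (intro powr_mono2) auto
    then show ?thesis
      using q I C A by (simp add: powr_powr powr_mult)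
  qed
  then show ?thesis
    using int by (simp add: nn_integral_eq_integral I_def ennreal_leI flip: h_def)
qed

text \<open>Simple functions \<open>u i\<close> dominated by 2 |f| converge to \<open>f\<close>, and
  \<open>fk\<close> lets their transforms converge pointwise. Fatou's lemma carries the bound
  over.\<close>

theorem riesz_thorin:
  assumes pq: "1 < p" "p \<le> 2" "1 / p + 1 / q = 1" and C: "0 < C"
    and L2: "\<And>f g. simple_function M f \<Longrightarrow> integrable M f \<Longrightarrow> simple_function N g \<Longrightarrow> integrable N g \<Longrightarrow>
      (norm (form f g))\<^sup>2 \<le> C * (\<integral>t. (norm (f t))\<^sup>2 \<partial>M) * (\<integral>y. (norm (g y))\<^sup>2 \<partial>N)"
    and f: "f \<in> borel_measurable M" and int: "integrable M (\<lambda>t. norm (f t) powr p)"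
    and fk: "\<And>y. y \<in> space N \<Longrightarrow> integrable M (\<lambda>t. f t * k t y)"
  shows "(\<integral>\<^sup>+y. ennreal (norm (\<integral>t. f t * k t y \<partial>M) powr q) \<partial>N)
    \<le> ennreal (C * (\<integral>t. norm (f t) powr p \<partial>M) powr (q / p))"
proof -
  obtain u where u: "\<And>i. simple_function M (u i)" "\<And>t. t \<in> space M \<Longrightarrow> (\<lambda>i. u i t) \<longlonglongrightarrow> f t"
    "\<And>i t. t \<in> space M \<Longrightarrow> norm (u i t) \<le> 2 * norm (f t)"
    using borel_measurable_implies_sequence_metric[OF f, of 0] by simp metis
  have q: "0 < q"
  proof -
    have "1 / q = 1 - 1 / p" "1 / p < 1"
      using pq by simp_all
    then have "0 < 1 / q"
      by linarith
    then show "0 < q"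
      by (simp only: zero_less_divide_1_iff)
  qed
  have [measurable]: "u i \<in> borel_measurable M" for i
    using u(1) by (rule borel_measurable_simple_function)
  note [measurable] = f
  have int2: "integrable M (\<lambda>t. 2 powr p * norm (f t) powr p)"
    using int by simp
  have le2: "norm (u i t) powr p \<le> 2 powr p * norm (f t) powr p" if "t \<in> space M" for i t
    using u(3)[OF that] pq by (subst powr_mult[symmetric]) (auto intro!: powr_mono2)
  have u_powr: "integrable M (\<lambda>t. norm (u i t) powr p)" for i
    using le2 by (intro Bochner_Integration.integrable_bound[OF int2] AE_I2) auto
  have u_int: "integrable M (u i)" for i
    using integrable_simple_compose[OF u(1) u_powr, of "\<lambda>c. c" i] by simp
  \<comment> \<open>The added null sequence makes the bound strictly positive even where
    \<open>u i\<close> vanishes, without changing the limit.\<close>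
  define A where "A i = (\<integral>t. norm (u i t) powr p \<partial>M) + inverse (real (Suc i))" for i
  have "(\<lambda>i. \<integral>t. norm (u i t) powr p \<partial>M) \<longlonglongrightarrow> (\<integral>t. norm (f t) powr p \<partial>M)"
  proof (rule integral_dominated_convergence[OF _ _ int2])
    show "AE t in M. (\<lambda>i. norm (u i t) powr p) \<longlonglongrightarrow> norm (f t) powr p"
      using pq by (intro AE_I2 tendsto_powr' tendsto_intros u) auto
    show "AE t in M. norm (norm (u i t) powr p) \<le> 2 powr p * norm (f t) powr p" for i
      using le2 by (intro AE_I2) auto
  qed auto
  from tendsto_add[OF this LIMSEQ_inverse_real_of_nat]
  have A_lim: "A \<longlonglongrightarrow> (\<integral>t. norm (f t) powr p \<partial>M)"
    by (simp add: A_def[abs_def])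
  have A_pos: "0 < A i" for i
    by (auto simp: A_def intro!: add_nonneg_pos)
  have lim: "(\<lambda>i. ennreal (norm (\<integral>t. u i t * k t y \<partial>M) powr q)) \<longlonglongrightarrow>
      ennreal (norm (\<integral>t. f t * k t y \<partial>M) powr q)" if y: "y \<in> space N" for y
  proof -
    have "(\<lambda>i. \<integral>t. u i t * k t y \<partial>M) \<longlonglongrightarrow> (\<integral>t. f t * k t y \<partial>M)"
    proof (rule integral_dominated_convergence[where w = "\<lambda>t. 2 * norm (f t * k t y)"])
      show "integrable M (\<lambda>t. 2 * norm (f t * k t y))"
        by (intro integrable_mult_right integrable_norm fk y)
      have "(\<lambda>t. k t y) \<in> borel_measurable M"
        using y by measurable
      then show "(\<lambda>t. f t * k t y) \<in> borel_measurable M" "(\<lambda>t. u i t * k t y) \<in> borel_measurable M" for i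
        by measurable
      show "AE t in M. (\<lambda>i. u i t * k t y) \<longlonglongrightarrow> f t * k t y"
        by (intro AE_I2 tendsto_intros u)
      show "AE t in M. norm (u i t * k t y) \<le> 2 * norm (f t * k t y)" for i
        using u(3) by (intro AE_I2) (auto simp: norm_mult mult.assoc[symmetric] intro!: mult_right_mono)
    qed
    then show ?thesis
      using q by (intro tendsto_intros tendsto_powr') auto
  qed
  have "(\<integral>\<^sup>+y. ennreal (norm (\<integral>t. f t * k t y \<partial>M) powr q) \<partial>N)
      = (\<integral>\<^sup>+y. liminf (\<lambda>i. ennreal (norm (\<integral>t. u i t * k t y \<partial>M) powr q)) \<partial>N)"
    by (intro nn_integral_cong lim_imp_Liminf[symmetric] lim) simp
  also have "\<dots> \<le> liminf (\<lambda>i. \<integral>\<^sup>+y. ennreal (norm (\<integral>t. u i t * k t y \<partial>M) powr q) \<partial>N)"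
    by (intro nn_integral_liminf) measurable
  also have "\<dots> \<le> liminf (\<lambda>i. ennreal (C * A i powr (q / p)))"
    by (intro Liminf_mono always_eventually allI
        riesz_thorin_simple_norm[OF pq C L2 u(1) u_int _ A_pos]) (auto simp: A_def)
  also have "\<dots> = ennreal (C * (\<integral>t. norm (f t) powr p \<partial>M) powr (q / p))"
    using pq q A_pos by (intro lim_imp_Liminf tendsto_intros tendsto_powr' A_lim)
      (auto intro!: always_eventually less_imp_le)
  finally show ?thesis .
qed

end

section \<open>The maximal Laplace transform\<close>

text \<open>Integrating (r |u| - |v|)^2 \<ge> 0 gives the quadratic inequality \<open>quad\<close>
  for every real r; the optimal choice is r = m / a.\<close>

lemma integral_Cauchy_Schwarz:
  fixes u v :: "'a \<Rightarrow> complex"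
  assumes [measurable]: "u \<in> borel_measurable M" "v \<in> borel_measurable M"
    and u: "integrable M (\<lambda>t. (norm (u t))\<^sup>2)" and v: "integrable M (\<lambda>t. (norm (v t))\<^sup>2)"
  shows "(norm (\<integral>t. u t * v t \<partial>M))\<^sup>2 \<le> (\<integral>t. (norm (u t))\<^sup>2 \<partial>M) * (\<integral>t. (norm (v t))\<^sup>2 \<partial>M)"
proof -
  define a where "a = (\<integral>t. (norm (u t))\<^sup>2 \<partial>M)"
  define b where "b = (\<integral>t. (norm (v t))\<^sup>2 \<partial>M)"
  define m where "m = (\<integral>t. norm (u t) * norm (v t) \<partial>M)"
  have a: "0 \<le> a"
    by (simp add: a_def)
  have uv: "integrable M (\<lambda>t. norm (u t) * norm (v t))"
  proof (rule Bochner_Integration.integrable_bound)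
    show "integrable M (\<lambda>t. (norm (u t))\<^sup>2 + (norm (v t))\<^sup>2)"
      using u v by simp
    show "AE t in M. norm (norm (u t) * norm (v t)) \<le> norm ((norm (u t))\<^sup>2 + (norm (v t))\<^sup>2)"
    proof (rule AE_I2)
      fix t
      have "norm (u t) * norm (v t) \<le> (norm (u t))\<^sup>2 + (norm (v t))\<^sup>2"
        using sum_squares_bound[of "norm (u t)" "norm (v t)"] mult_nonneg_nonneg[OF norm_ge_zero norm_ge_zero, of "u t" "v t"]
        unfolding mult.assoc by linarith
      then show "norm (norm (u t) * norm (v t)) \<le> norm ((norm (u t))\<^sup>2 + (norm (v t))\<^sup>2)"
        by simp
    qed
  qed measurable
  have quad: "2 * r * m \<le> r\<^sup>2 * a + b" for r
  proof -
    have "(\<integral>t. 2 * r * (norm (u t) * norm (v t)) \<partial>M) \<le> (\<integral>t. r\<^sup>2 * (norm (u t))\<^sup>2 + (norm (v t))\<^sup>2 \<partial>M)"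
    proof (rule integral_mono)
      show "2 * r * (norm (u t) * norm (v t)) \<le> r\<^sup>2 * (norm (u t))\<^sup>2 + (norm (v t))\<^sup>2" for t
        using sum_squares_bound[of "r * norm (u t)" "norm (v t)"] by (simp add: power_mult_distrib mult_ac)
    qed (use u v uv in auto)
    then show ?thesis
      using u v by (simp add: m_def a_def b_def)
  qed
  have "m\<^sup>2 \<le> a * b"
  proof (cases "a = 0")
    case True
    have "m = 0"
    proof (rule ccontr)
      \<comment> \<open>With a = 0 the inequality reads 2 r m \<le> b; this r turns it into 2 (b +
        1) \<le> b, while r = 0 gives b \<ge> 0.\<close>
      assume "m \<noteq> 0"
      then show False
        using quad[of "(b + 1) / m"] True quad[of 0] by simp
    qed
    then show ?thesis using True by simp
  next
    case False
    then show ?thesis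
      using quad[of "m / a"] a by (simp add: field_simps power2_eq_square)
  qed
  moreover have "norm (\<integral>t. u t * v t \<partial>M) \<le> m"
    unfolding m_def using integral_norm_bound[of M "\<lambda>t. u t * v t"] by (simp add: norm_mult)
  then have "(norm (\<integral>t. u t * v t \<partial>M))\<^sup>2 \<le> m\<^sup>2"
    by (intro power_mono) auto
  ultimately show ?thesis
    by (simp add: a_def b_def)
qed

text \<open>The bound depends neither on \<open>x\<close> and its lower bound \<open>a\<close> nor
  on the window, so the supremum and the whole line can be reached by monotone limits.\<close>

lemma laplace_linearized_bound:
  assumes pq: "1 < p" "p \<le> 2" "1 / p + 1 / q = 1" and f: "f \<in> Lp_pos p"
    and a: "0 < a" and x: "\<And>y. a \<le> x y" and x_meas: "x \<in> borel_measurable borel"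
  shows "(\<integral>\<^sup>+y. ennreal (norm (laplace f (Complex (x y) y)) powr q) \<partial>restrict_space lborel {b..c})
    \<le> ennreal (32 * pi * (\<integral>t. norm (f t) powr p \<partial>lebesgue_on {0<..}) powr (q / p))"
proof -
  let ?M = "lebesgue_on {0::real<..}" and ?N = "restrict_space lborel {b..c}"
  interpret M: sigma_finite_measure ?M
    by (rule sigma_finite_lebesgue_on_pos)
  interpret N: finite_measure ?N
    by (rule finite_measure_lborel_Icc)
  have x_nonneg: "0 \<le> x y" for y
    using a x[of y] by linarith
  interpret K: bounded_kernel ?M ?N "vkernel x"
    by unfold_locales (use x_nonneg x_meas in \<open>auto simp: norm_vkernel\<close>)
  \<comment> \<open>By Fubini the form pairs \<open>u\<close> with the transpose of
    \<open>g\<close>; Cauchy--Schwarz and the L^2 bound for the transpose finish.\<close>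
  have L2: "(norm (K.form u g))\<^sup>2 \<le> 32 * pi * (\<integral>t. (norm (u t))\<^sup>2 \<partial>?M) * (\<integral>y. (norm (g y))\<^sup>2 \<partial>?N)"
    if u: "simple_function ?M u" "integrable ?M u" and g: "simple_function ?N g" "integrable ?N g" for u g
  proof -
    have u2: "integrable ?M (\<lambda>t. (norm (u t))\<^sup>2)" and g2: "integrable ?N (\<lambda>y. (norm (g y))\<^sup>2)"
      using integrable_simple_compose[OF u(1), of 1 "\<lambda>c. (norm c)\<^sup>2"] u(2)
        integrable_simple_compose[OF g(1), of 1 "\<lambda>c. (norm c)\<^sup>2"] g(2) by simp_all
    note V = dual_laplace_L2[OF a x x_meas g(2) g2]
    have "dual_laplace b c x g \<in> borel_measurable ?M"
      unfolding dual_laplace_def using K.k_meas borel_measurable_integrable[OF g(2)] by measurable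
    then have "(norm (\<integral>t. u t * dual_laplace b c x g t \<partial>?M))\<^sup>2
        \<le> (\<integral>t. (norm (u t))\<^sup>2 \<partial>?M) * (\<integral>t. (norm (dual_laplace b c x g t))\<^sup>2 \<partial>?M)"
      using borel_measurable_integrable[OF u(2)] by (intro integral_Cauchy_Schwarz u2 V(2))
    also have "\<dots> \<le> (\<integral>t. (norm (u t))\<^sup>2 \<partial>?M) * (32 * pi * (\<integral>y. (norm (g y))\<^sup>2 \<partial>?N))"
      by (intro mult_left_mono V(1)) simp
    finally show ?thesis
      unfolding K.form_fst[OF u(2) g(2)] dual_laplace_def by (simp only: mult_ac)
  qed
  have fk: "integrable ?M (\<lambda>t. f t * vkernel x t y)" for y
    unfolding vkernel_def using laplace_integrable[OF f, of "Complex (x y) y"] pq a x[of y] by simp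
  have "f \<in> borel_measurable ?M" "integrable ?M (\<lambda>t. norm (f t) powr p)"
    using f by (auto simp: Lp_pos_def)
  from K.riesz_thorin[OF pq _ L2 this fk] show ?thesis
    by (simp add: laplace_def vkernel_def)
qed

section \<open>Linearizing the supremum\<close>

text \<open>Induction on \<open>X\<close>: the new point replaces the selection where its value is
  at least as large. \<open>F\<close> is measurable only for each fixed x, so measurability of the
  selected value is carried through the induction.\<close>

lemma measurable_argmax:
  fixes F :: "real \<Rightarrow> 'a \<Rightarrow> real"
  assumes "finite X" "X \<noteq> {}" "\<And>x. x \<in> X \<Longrightarrow> F x \<in> borel_measurable M"
  shows "\<exists>s\<in>borel_measurable M. (\<lambda>y. F (s y) y) \<in> borel_measurable M \<and>
    (\<forall>y. s y \<in> X \<and> (\<forall>x\<in>X. F x y \<le> F (s y) y))"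
  using assms
proof (induction X rule: finite_ne_induct)
  case (singleton x)
  then show ?case
    by (intro bexI[of _ "\<lambda>_. x"]) auto
next
  case (insert x X)
  then obtain s where [measurable]: "s \<in> borel_measurable M" "(\<lambda>y. F (s y) y) \<in> borel_measurable M"
    and s: "\<And>y. s y \<in> X" "\<And>y z. z \<in> X \<Longrightarrow> F z y \<le> F (s y) y"
    by auto
  have [measurable]: "F x \<in> borel_measurable M"
    using insert.prems by simp
  let ?s = "\<lambda>y. if F (s y) y \<le> F x y then x else s y"
  have "(\<lambda>y. if F (s y) y \<le> F x y then F x y else F (s y) y) \<in> borel_measurable M"
    by measurable
  then have "(\<lambda>y. F (?s y) y) \<in> borel_measurable M"
    by (simp add: if_distrib[of "\<lambda>z. F z _"] cong: if_cong)
  moreover have "?s \<in> borel_measurable M"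
    by measurable
  moreover have "F z y \<le> F (?s y) y" if "z \<in> insert x X" for y z
    using that s(2)[of z y] by auto
  ultimately show ?case
    using s(1) by (intro bexI[of _ ?s]) auto
qed

text \<open>To the right of \<open>a\<close> the integrand is dominated by its absolute value at the
  real point \<open>a\<close>.\<close>

lemma continuous_laplace_horizontal:
  assumes "f \<in> Lp_pos p" "1 \<le> p" "0 < a"
  shows "continuous_on {a<..} (\<lambda>x. laplace f (Complex x y))"
proof -
  have "(\<lambda>n. laplace f (Complex (u n) y)) \<longlonglongrightarrow> laplace f (Complex x y)"
    if u: "u \<longlonglongrightarrow> x" "\<And>n. a < u n" "a < x" for u x
    unfolding laplace_def
  proof (rule integral_dominated_convergence
      [where w = "\<lambda>t. norm (f t * exp (- (Complex a 0 * of_real t)))"])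
    show "integrable (lebesgue_on {0<..}) (\<lambda>t. norm (f t * exp (- (Complex a 0 * of_real t))))"
      using laplace_integrable[OF assms(1,2), of "Complex a 0"] assms(3)
      by (intro integrable_norm) auto
    show "AE t in lebesgue_on {0<..}.
        (\<lambda>n. f t * exp (- (Complex (u n) y * of_real t))) \<longlonglongrightarrow> f t * exp (- (Complex x y * of_real t))"
      unfolding Complex_eq by (intro AE_I2 tendsto_intros u)
    show "(\<lambda>t. f t * exp (- (Complex x y * of_real t))) \<in> borel_measurable (lebesgue_on {0<..})"
      "(\<lambda>t. f t * exp (- (Complex (u n) y * of_real t))) \<in> borel_measurable (lebesgue_on {0<..})" for n
      using laplace_integrable[OF assms(1,2), of "Complex x y"]
        laplace_integrable[OF assms(1,2), of "Complex (u n) y"] assms(3) u(2)[of n] u(3)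
      by auto
    show "AE t in lebesgue_on {0<..}. norm (f t * exp (- (Complex (u n) y * of_real t)))
        \<le> norm (f t * exp (- (Complex a 0 * of_real t)))" for n
      using u(2)[of n] by (intro AE_I2) (auto simp: norm_mult intro!: mult_left_mono)
  qed
  then show ?thesis
    unfolding continuous_on_sequentially by (auto simp: o_def)
qed

text \<open>By continuity in x, a value above \<open>B\<close> at some height would persist at a
  nearby rational height.\<close>

lemma max_laplace_le:
  assumes f: "f \<in> Lp_pos p" "1 \<le> p"
    and le: "\<And>x. x \<in> \<rat> \<Longrightarrow> 0 < x \<Longrightarrow> norm (laplace f (Complex x y)) \<le> B"
  shows "max_laplace f y \<le> ennreal B"
  unfolding max_laplace_def
proof (rule SUP_least, rule ennreal_leI, rule ccontr)
  fix x :: real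
  assume x: "x \<in> {0<..}" and "\<not> norm (laplace f (Complex x y)) \<le> B"
  let ?S = "{x/2<..} \<inter> (\<lambda>x. norm (laplace f (Complex x y))) -` {B<..}"
  have "open ?S"
    using x continuous_laplace_horizontal[OF f, of "x / 2" y]
    by (intro continuous_open_preimage continuous_on_norm) auto
  moreover have "x \<in> ?S"
    using x \<open>\<not> norm (laplace f (Complex x y)) \<le> B\<close> by auto
  ultimately obtain e where e: "0 < e" "ball x e \<subseteq> ?S"
    by (rule openE)
  obtain r where r: "r \<in> \<rat>" "x < r" "r < x + e"
    using Rats_dense_in_real[of x "x + e"] e by auto
  then have "r \<in> ball x e"
    by (simp add: dist_real_def)
  then have "B < norm (laplace f (Complex r y))"
    using e(2) by auto
  then show False
    using le[of r] r x by auto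
qed

text \<open>Maximizing over growing finite sets of rational heights and over windows growing to the
  whole line gives an increasing sequence, bounded by the linearized estimate. Monotone convergence
  gives the full supremum.\<close>

lemma nn_integral_max_laplace_le:
  assumes pq: "1 < p" "p \<le> 2" "1 / p + 1 / q = 1" and f: "f \<in> Lp_pos p"
  shows "(\<integral>\<^sup>+ y. ennreal_powr (max_laplace f y) q \<partial>lborel)
    \<le> ennreal (32 * pi * (\<integral>t. norm (f t) powr p \<partial>lebesgue_on {0<..}) powr (q / p))"
proof -
  define L where "L x y = norm (laplace f (Complex x y))" for x y
  define X where "X n = from_nat_into (\<rat> \<inter> {0::real<..}) ` {..n::nat}" for n
  have q: "0 < q"
  proof -
    have "1 / q = 1 - 1 / p" "1 / p < 1"
      using pq by simp_all
    then have "0 < 1 / q"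
      by linarith
    then show ?thesis
      by (simp only: zero_less_divide_1_iff)
  qed
  have ne: "\<rat> \<inter> {0::real<..} \<noteq> {}"
    by (auto intro!: exI[of _ 1])
  have count: "countable (\<rat> \<inter> {0::real<..})"
    by (intro countable_Int1 countable_rat)
  have X: "finite (X n)" "X n \<noteq> {}" "X n \<subseteq> {0<..}" for n
    using from_nat_into[OF ne] by (auto simp: X_def)
  have L_meas: "L x \<in> borel_measurable borel" if "0 < x" for x
    unfolding L_def using continuous_laplace_vertical[OF f _ that] pq
    by (intro borel_measurable_continuous_onI continuous_on_norm) auto
  have "\<exists>s\<in>borel_measurable borel. (\<lambda>y. L (s y) y) \<in> borel_measurable borel \<and>
      (\<forall>y. s y \<in> X n \<and> (\<forall>x\<in>X n. L x y \<le> L (s y) y))" for n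
    using X[of n] by (intro measurable_argmax L_meas) auto
  then obtain s where s_meas: "\<And>n. s n \<in> borel_measurable borel"
    and Ls_meas [measurable]: "\<And>n. (\<lambda>y. L (s n y) y) \<in> borel_measurable borel"
    and s: "\<And>n y. s n y \<in> X n" "\<And>n y x. x \<in> X n \<Longrightarrow> L x y \<le> L (s n y) y"
    by metis
  define G where "G n y = ennreal (L (s n y) y powr q) * indicator {- real n..real n} y" for n y
  let ?B = "ennreal (32 * pi * (\<integral>t. norm (f t) powr p \<partial>lebesgue_on {0<..}) powr (q / p))"
  have "(\<integral>\<^sup>+ y. G n y \<partial>lborel) \<le> ?B" for n
  proof -
    \<comment> \<open>Finiteness of \<open>X n\<close> provides the positive lower bound that the
      linearized estimate requires.\<close>
    have "0 < Min (X n)" "\<And>y. Min (X n) \<le> s n y"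
      using X[of n] s(1) by auto
    from laplace_linearized_bound[OF pq f this s_meas, of "- real n" "real n"]
    show ?thesis
      by (simp add: G_def L_def nn_integral_restrict_space)
  qed
  moreover have "incseq G"
  proof (intro incseq_SucI le_funI)
    fix n y
    have "X n \<subseteq> X (Suc n)"
      by (auto simp: X_def)
    then have "L (s n y) y \<le> L (s (Suc n) y) y"
      using s by blast
    then show "G n y \<le> G (Suc n) y"
      using q by (auto simp: G_def L_def indicator_def intro!: ennreal_leI powr_mono2)
  qed
  then have "(\<integral>\<^sup>+ y. (SUP n. G n y) \<partial>lborel) = (SUP n. \<integral>\<^sup>+ y. G n y \<partial>lborel)"
    by (rule nn_integral_monotone_convergence_SUP) (simp add: G_def[abs_def])
  ultimately have "(\<integral>\<^sup>+ y. (SUP n. G n y) \<partial>lborel) \<le> ?B"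
    by (auto intro: SUP_least)
  moreover have "ennreal_powr (max_laplace f y) q \<le> (SUP n. G n y)" for y
  proof (cases "SUP n. G n y")
    case (real S)
    have "L x y \<le> S powr (1 / q)" if x: "x \<in> \<rat>" "0 < x" for x
    proof -
      obtain j where j: "x = from_nat_into (\<rat> \<inter> {0<..}) j"
        using from_nat_into_surj[OF count, of x] x by auto
      \<comment> \<open>Large enough both for \<open>x\<close> to be among the selected heights and
        for y to lie in the window.\<close>
      define n where "n = max j (nat \<lceil>\<bar>y\<bar>\<rceil>)"
      have "x \<in> X n"
        unfolding X_def j n_def by (intro imageI) simp
      moreover have "\<bar>y\<bar> \<le> real n"
        unfolding n_def by linarith
      ultimately have "ennreal (L x y powr q) \<le> G n y"
        using q s(2)[of x n y] by (auto simp: G_def L_def indicator_def intro!: ennreal_leI powr_mono2)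
      also have "\<dots> \<le> ennreal S"
        unfolding real(2)[symmetric] by (rule SUP_upper) simp
      finally have "L x y powr q \<le> S"
        using real(1) by simp
      then have "(L x y powr q) powr (1 / q) \<le> S powr (1 / q)"
        using q by (intro powr_mono2) auto
      then show ?thesis
        using q by (simp add: powr_powr L_def)
    qed
    then have le: "max_laplace f y \<le> ennreal (S powr (1 / q))"
      using pq by (intro max_laplace_le[OF f]) (auto simp: L_def)
    then obtain m where m: "max_laplace f y = ennreal m" "0 \<le> m"
      by (cases "max_laplace f y") (auto simp: top_unique)
    then have "m \<le> S powr (1 / q)"
      using le by simp
    then have "m powr q \<le> (S powr (1 / q)) powr q"
      using m q by (intro powr_mono2) auto
    then show ?thesis
      using m q real by (simp add: ennreal_powr_def powr_powr ennreal_leI)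
  next
    case top
    then show ?thesis
      by (simp only: top_greatest)
  qed
  then have "(\<integral>\<^sup>+ y. ennreal_powr (max_laplace f y) q \<partial>lborel) \<le> (\<integral>\<^sup>+ y. (SUP n. G n y) \<partial>lborel)"
    by (intro nn_integral_mono)
  ultimately show ?thesis
    by (rule order_trans[rotated])
qed

theorem theorem10:
  fixes p q :: real
  assumes "1 < p" and "p \<le> 2" and "1 / p + 1 / q = 1"
  shows "\<exists>K::real. 0 \<le> K \<and> K \<le> (192 * pi) powr (1 / q) \<and>
    (\<forall>f\<in>Lp_pos p.
      ennreal_powr (\<integral>\<^sup>+ y. ennreal_powr (max_laplace f y) q \<partial>lborel) (1 / q)
        \<le> ennreal (K * Lp_norm_pos p f) \<and>
      (AE y in lborel. max_laplace f y < \<infinity>))"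
proof (intro exI[of _ "(32 * pi) powr (1 / q)"] conjI ballI)
  \<comment> \<open>The witness interpolates between norm 1 and the L^2 norm bound
    \<open>sqrt (32 * pi)\<close>; the latter enters with exponent 2/q.\<close>
  have "1 / q = 1 - 1 / p" "1 / p < 1"
    using assms by simp_all
  then have "0 < 1 / q"
    by linarith
  then have q: "0 < q"
    by (simp only: zero_less_divide_1_iff)
  then show "(32 * pi) powr (1 / q) \<le> (192 * pi) powr (1 / q)"
    by (intro powr_mono2) auto
  fix f assume f: "f \<in> Lp_pos p"
  let ?A = "\<integral>t. norm (f t) powr p \<partial>lebesgue_on {0<..}"
  let ?J = "\<integral>\<^sup>+ y. ennreal_powr (max_laplace f y) q \<partial>lborel"
  have le: "?J \<le> ennreal (32 * pi * ?A powr (q / p))"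
    by (rule nn_integral_max_laplace_le[OF assms f])
  then obtain j where j: "?J = ennreal j" "0 \<le> j"
    by (cases ?J) (auto simp: top_unique)
  then have "j \<le> 32 * pi * ?A powr (q / p)"
    using le by (simp add: ennreal_le_iff)
  then have "j powr (1 / q) \<le> (32 * pi * ?A powr (q / p)) powr (1 / q)"
    using j q by (intro powr_mono2) auto
  also have "\<dots> = (32 * pi) powr (1 / q) * ?A powr (1 / p)"
    using q by (simp add: powr_mult powr_powr)
  finally show "ennreal_powr ?J (1 / q) \<le> ennreal ((32 * pi) powr (1 / q) * Lp_norm_pos p f)"
    using j by (simp add: ennreal_powr_def Lp_norm_pos_def ennreal_leI)
  have "(\<lambda>y. ennreal_powr (max_laplace f y) q) \<in> borel_measurable lborel"
    using measurable_compose[OF borel_measurable_max_laplace[OF f] borel_measurable_ennreal_powr] assms(1)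
    by simp
  moreover have "?J \<noteq> \<infinity>"
    using j by simp
  \<comment> \<open>\<open>ennreal_powr\<close> is infinite exactly at infinity, so finiteness of
    the integral forces finiteness of the maximal function almost everywhere.\<close>
  ultimately have "AE y in lborel. ennreal_powr (max_laplace f y) q \<noteq> \<infinity>"
    by (rule nn_integral_PInf_AE)
  then show "AE y in lborel. max_laplace f y < \<infinity>"
    by eventually_elim (auto simp: ennreal_powr_def less_top split: if_splits)
qed simp

end
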